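(* Let $b>a>0$. For each $s\in(0,1)$ let $\psi_s:\mathbb{R}\to[a,b]$ with $\psi_s(0)=1$, and let $f_s(x)=x^s\psi_s(\log x)$ (for $x>0$, extended by continuity at $0$) be such that $g_s(x)=-x^2f_s''(x)$ satisfies $g_s\ge0$ and $x^2g_s''(x)+g_s(\alpha)g_s(x/\alpha)\le0$ for all $x\ge0$, $\alpha>0$. Consider a memoryless channel $W_{Y|X}$ on finite alphabets $\mathcal{X},\mathcal{Y}$ with $W_{\min}=\min_{x,y}W_{Y|X}(y|x)>0$, used with blocklength $n$, a message set of size $|\mathcal{M}|=e^{nR}$, any encoder and decoder, and maximal error probability $P_e^{\max}=\max_m\Pr(\hat M\ne M\mid M=m)$. Let $G(x)=-\log(1-x)$ and $\tilde f_s(x)=x\big(1-f_s(1/x)\big)$, and define $$\mathtt{E}_{f\text{-}\mathrm{sp}}(R)=\sup_{p_X}\sup_{s\in(0,1)}\left[\frac{I_{G,\tilde f_s}(X;Y)}{1-s}-\frac{s}{1-s}R\right],$$ where $Y$ is the output of $W_{Y|X}$ with input $X\sim p_X$. Then for any positive rate $R$, $$P_e^{\max}>\exp\Big\{-n\Big(\mathtt{E}_{f\text{-}\mathrm{sp}}\big(R-\mathcal{O}(\tfrac1n)\big)+\mathcal{O}(\tfrac{1}{\sqrt n})\Big)\Big\},$$ where the $\mathcal{O}$ terms refer to $n\to\infty$ with implied constants not depending on the code. Consequently the error exponent satisfies $\mathscr{E}(R)\le \mathtt{E}_{f\text{-}\mathrm{sp}}(R)$.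
   Context: For distributions $p\ll q$ on a finite set and a function $h$ on $[0,\infty)$, $D_h(p\|q)=\sum_y q(y)h(p(y)/q(y))$ with $0h(0/0)=0$. For random variables $X,Y$ on finite sets, $I_{G,h}(X;Y)=\min_{q_Y}\sum_x p_X(x)\,G(D_h(p_{Y|X=x}\|q_Y))$. The error exponent is $\mathscr{E}(R)=\limsup -\frac{1}{n}\log P_e^{\max}$, the limsup taken over codes of rate $R$ as $n\to\infty$. *)

theory Defs
  imports "HOL-Probability.Probability"
begin

text \<open>D_h(p||q) = sum_y q(y) h(p(y)/q(y)), with the convention 0 h(0/0) = 0.
  It is only used for p absolutely continuous w.r.t. q (enforced in I_G_h).\<close>
definition Dh :: "(real \<Rightarrow> real) \<Rightarrow> 'y::finite pmf \<Rightarrow> 'y pmf \<Rightarrow> real" where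
  "Dh h P Q = (\<Sum>y\<in>UNIV. if pmf Q y = 0 then 0 else pmf Q y * h (pmf P y / pmf Q y))"

definition I_G_h :: "(real \<Rightarrow> real) \<Rightarrow> (real \<Rightarrow> real) \<Rightarrow> 'x::finite pmf \<Rightarrow> ('x \<Rightarrow> 'y::finite pmf) \<Rightarrow> real" where
  "I_G_h G h p W = Inf ((\<lambda>q. \<Sum>x\<in>UNIV. pmf p x * G (Dh h (W x) q)) `
      {q. \<forall>x y. pmf p x > 0 \<longrightarrow> pmf (W x) y > 0 \<longrightarrow> pmf q y > 0})"

definition Gfun :: "real \<Rightarrow> real" where
  "Gfun x = - ln (1 - x)"

definition fs :: "(real \<Rightarrow> real \<Rightarrow> real) \<Rightarrow> real \<Rightarrow> real \<Rightarrow> real" where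
  "fs \<psi> s x = (if x > 0 then x powr s * \<psi> s (ln x) else 0)"

definition gs :: "(real \<Rightarrow> real \<Rightarrow> real) \<Rightarrow> real \<Rightarrow> real \<Rightarrow> real" where
  "gs \<psi> s x = - (x ^ 2) * deriv (deriv (fs \<psi> s)) x"

definition ftilde :: "(real \<Rightarrow> real \<Rightarrow> real) \<Rightarrow> real \<Rightarrow> real \<Rightarrow> real" where
  "ftilde \<psi> s x = x * (1 - fs \<psi> s (1 / x))"

definition E_fsp :: "(real \<Rightarrow> real \<Rightarrow> real) \<Rightarrow> ('x::finite \<Rightarrow> 'y::finite pmf) \<Rightarrow> real \<Rightarrow> ereal" where
  "E_fsp \<psi> W R = (SUP p\<in>(UNIV :: 'x pmf set). SUP s\<in>{0<..<1::real}.
      ereal (I_G_h Gfun (ftilde \<psi> s) p W / (1 - s) - s / (1 - s) * R))"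

text \<open>Messages are 0..<M, the encoder maps a message to a length-n input word,
  the decoder maps an output word to a message guess.  Conditional error probability
  Pr(Mhat \<noteq> m | M = m) under the memoryless channel W.\<close>
definition msg_err :: "('x \<Rightarrow> 'y::finite pmf) \<Rightarrow> nat \<Rightarrow> (nat \<Rightarrow> 'x list) \<Rightarrow> ('y list \<Rightarrow> nat) \<Rightarrow> nat \<Rightarrow> real" where
  "msg_err W n enc dec m =
     (\<Sum>ys\<in>{ys. length ys = n \<and> dec ys \<noteq> m}. \<Prod>i<n. pmf (W (enc m ! i)) (ys ! i))"

definition Pe_max :: "('x \<Rightarrow> 'y::finite pmf) \<Rightarrow> nat \<Rightarrow> nat \<Rightarrow> (nat \<Rightarrow> 'x list) \<Rightarrow> ('y list \<Rightarrow> nat) \<Rightarrow> real" where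
  "Pe_max W n M enc dec = Max ((\<lambda>m. msg_err W n enc dec m) ` {..<M})"

definition is_code :: "nat \<Rightarrow> real \<Rightarrow> nat \<Rightarrow> (nat \<Rightarrow> 'x list) \<Rightarrow> bool" where
  "is_code n R M enc \<longleftrightarrow> real M \<ge> exp (real n * R) \<and> (\<forall>m<M. length (enc m) = n)"

definition best_err :: "('x \<Rightarrow> 'y::finite pmf) \<Rightarrow> nat \<Rightarrow> real \<Rightarrow> real" where
  "best_err W n R = Inf {Pe_max W n M enc dec | M enc dec. is_code n R M enc}"

definition error_exponent :: "('x \<Rightarrow> 'y::finite pmf) \<Rightarrow> real \<Rightarrow> ereal" where
  "error_exponent W R = limsup (\<lambda>n. if best_err W n R = 0 then \<infinity>
                                      else ereal (- ln (best_err W n R) / real n))"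

end

(* With L the likelihood ratio q/W_x under W_x, the differential inequality for g makes
   f supermultiplicative in the mean: E f(L_1 L_2) >= E f(L_1) E f(L_2) for independent L_1, L_2.
   Tensorising and using f x <= b x^s gives E f(L) <= E L^s, so E_fsp dominates the classical sphere
   packing exponent. The latter is bounded following Haroutunian: for every input type there is, by
   Lagrangian duality, an auxiliary channel V with mutual information at most (1 - l) R and
   D(V || W) close to the exponent. Decoding at rate R fails under V for some message, and a
   Chebyshev change of measure from V to W costs a factor exp (O(sqrt n)). Since W > 0, the number
   of types, polynomial in n, and the rate loss l = O(1/sqrt n) are absorbed into this factor;
   the theorem holds with delta = 0. *)
theory Submission
  imports Defs
begin

section \<open>Product measures on words\<close>

text \<open>The auxiliary law \<open>V\<close> used at a message depends on its codeword, so the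
  decoding regions are not disjoint events of one law. They are therefore measured under the output
  law of \<open>V\<close>, which depends on the codeword only through its type: over all messages
  the regions have total mass at most 1 under each such law. This is why two log likelihood ratios
  must be controlled under \<open>V\<close>: against the output law, for the rate, and against the
  channel, for the exponent. Uniformity over codes rests on two facts. The second moments of both
  ratios have bounds free of \<open>V\<close>, because \<open>t * (ln t)\<^sup>2\<close> is bounded
  on (0, 1]. And the rate is lowered only by a fraction \<open>l\<close> that pays for the
  deviation, the number of types and a constant; the dual value is convex in the rate and at most
  \<open>L\<close> (minus the logarithm of the smallest channel entry) at rate 0, so the exponent
  rises by at most \<open>l * L\<close>. An infinite \<open>E_fsp\<close> makes both claims
  immediate. A finite one enters only through the lower bounds \<open>k\<close> that it dominates,
  so the infimum inside it is never evaluated.\<close>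

abbreviation words :: "nat \<Rightarrow> 'a list set" where
  "words n \<equiv> {ys. length ys = n}"

lemma finite_words [simp]: "finite (words n :: 'a::finite list set)"
  using finite_lists_length_eq[of "UNIV :: 'a set" n] by simp

lemma sum_words_Suc:
  "(\<Sum>ys\<in>words (Suc n). F ys) = (\<Sum>y\<in>UNIV. \<Sum>ys\<in>words n. F (y # ys))"
  for F :: "'a::finite list \<Rightarrow> 'b::comm_monoid_add"
proof -
  have eq: "words (Suc n) = (\<lambda>(y, ys). y # ys) ` (UNIV \<times> words n)"
    by (auto simp: length_Suc_conv image_iff)
  have "inj_on (\<lambda>(y, ys). y # ys) (UNIV \<times> words n)"
    by (auto simp: inj_on_def)
  then show ?thesis
    unfolding eq by (subst sum.reindex) (auto simp: sum.cartesian_product intro!: sum.cong)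
qed

lemma prod_Cons_nth:
  "(\<Prod>i<Suc n. v i ((y # ys) ! i)) = v 0 y * (\<Prod>i<n. v (Suc i) (ys ! i))"
  by (subst prod.lessThan_Suc_shift) simp

lemma sum_words_prod:
  "(\<Sum>ys\<in>words n. \<Prod>i<n. v i (ys ! i)) = (\<Prod>i<n. \<Sum>y\<in>UNIV. v i y)"
  for v :: "nat \<Rightarrow> 'a::finite \<Rightarrow> real"
proof (induction n arbitrary: v)
  case (Suc n)
  show ?case
    unfolding sum_words_Suc prod_Cons_nth
    by (simp add: sum_distrib_left[symmetric] sum_distrib_right[symmetric]
        Suc.IH[of "\<lambda>i. v (Suc i)"] prod.lessThan_Suc_shift del: prod.lessThan_Suc)
qed simp

text \<open>Both moments share one induction because the cross term of the squared sum contains the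
  first moment of the tail. The laws \<open>v i\<close> vary with the position since they will
  depend on the input letter there.\<close>

lemma centered_sum_moments:
  fixes v z :: "nat \<Rightarrow> 'a::finite \<Rightarrow> real"
  assumes "\<And>i. i < n \<Longrightarrow> (\<Sum>y\<in>UNIV. v i y) = 1"
    and "\<And>i. i < n \<Longrightarrow> (\<Sum>y\<in>UNIV. v i y * z i y) = 0"
  shows "(\<Sum>ys\<in>words n. (\<Prod>i<n. v i (ys ! i)) * (\<Sum>i<n. z i (ys ! i))) = 0 \<and>
    (\<Sum>ys\<in>words n. (\<Prod>i<n. v i (ys ! i)) * (\<Sum>i<n. z i (ys ! i))\<^sup>2) =
      (\<Sum>i<n. \<Sum>y\<in>UNIV. v i y * (z i y)\<^sup>2)"
  using assms
proof (induction n arbitrary: v z)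
  case (Suc n)
  let ?p = "\<lambda>ys. \<Prod>i<n. v (Suc i) (ys ! i)"
  let ?s = "\<lambda>ys. \<Sum>i<n. z (Suc i) (ys ! i)"
  have p1: "(\<Sum>ys\<in>words n. ?p ys) = 1"
    using Suc.prems(1) by (subst sum_words_prod[of "\<lambda>i. v (Suc i)"]) simp
  have s0: "(\<Sum>ys\<in>words n. ?p ys * ?s ys) = 0"
    using Suc.prems by (intro conjunct1[OF Suc.IH]) auto
  have s2: "(\<Sum>ys\<in>words n. ?p ys * (?s ys)\<^sup>2) =
      (\<Sum>i<n. \<Sum>y\<in>UNIV. v (Suc i) y * (z (Suc i) y)\<^sup>2)"
    using Suc.prems by (intro conjunct2[OF Suc.IH]) auto
  have sum_Cons: "(\<Sum>i<Suc n. z i ((y # ys) ! i)) = z 0 y + ?s ys" for y ys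
    by (subst sum.lessThan_Suc_shift) simp
  have v0: "(\<Sum>y\<in>UNIV. v 0 y) = 1" "(\<Sum>y\<in>UNIV. v 0 y * z 0 y) = 0"
    using Suc.prems by auto
  have 1: "(\<Sum>ys\<in>words n. (v 0 y * ?p ys) * (z 0 y + ?s ys)) =
      v 0 y * z 0 y * (\<Sum>ys\<in>words n. ?p ys) + v 0 y * (\<Sum>ys\<in>words n. ?p ys * ?s ys)" for y
    by (simp add: sum_distrib_left sum.distrib[symmetric] algebra_simps)
  have sq: "a * p * (c + d)\<^sup>2 = a * c\<^sup>2 * p + 2 * a * c * (p * d) + a * (p * d\<^sup>2)" for a p c d :: real
    by algebra
  have 2: "(\<Sum>ys\<in>words n. (v 0 y * ?p ys) * (z 0 y + ?s ys)\<^sup>2) =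
      v 0 y * (z 0 y)\<^sup>2 * (\<Sum>ys\<in>words n. ?p ys) +
      2 * v 0 y * z 0 y * (\<Sum>ys\<in>words n. ?p ys * ?s ys) +
      v 0 y * (\<Sum>ys\<in>words n. ?p ys * (?s ys)\<^sup>2)" for y
    by (simp only: sq sum_distrib_left sum.distrib)
  show ?case
    unfolding sum_words_Suc prod_Cons_nth sum_Cons 1 2 p1 s0 s2
    by (simp add: v0 sum.distrib sum_distrib_right[symmetric]
        sum.lessThan_Suc_shift del: sum.lessThan_Suc)
qed simp

text \<open>The variance is bounded by the raw second moment, so an application need not centre the
  summands.\<close>

lemma Chebyshev_words:
  fixes v Z :: "nat \<Rightarrow> 'a::finite \<Rightarrow> real"
  assumes v: "\<And>i. i < n \<Longrightarrow> (\<Sum>y\<in>UNIV. v i y) = 1" "\<And>i y. v i y \<ge> 0"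
    and D: "D = (\<Sum>i<n. \<Sum>y\<in>UNIV. v i y * Z i y)"
    and var: "(\<Sum>i<n. \<Sum>y\<in>UNIV. v i y * (Z i y)\<^sup>2) \<le> \<sigma>" and t: "0 < t"
  shows "(\<Sum>ys | length ys = n \<and> (\<Sum>i<n. Z i (ys ! i)) > D + t. \<Prod>i<n. v i (ys ! i)) \<le> \<sigma> / t\<^sup>2"
proof -
  define m where "m i = (\<Sum>y\<in>UNIV. v i y * Z i y)" for i
  define z where "z i y = Z i y - m i" for i y
  let ?p = "\<lambda>ys. \<Prod>i<n. v i (ys ! i)"
  have p: "?p ys \<ge> 0" for ys
    by (simp add: prod_nonneg v)
  have z0: "(\<Sum>y\<in>UNIV. v i y * z i y) = 0" if "i < n" for i
    using v(1)[OF that]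
    by (simp add: z_def right_diff_distrib sum_subtractf sum_distrib_right[symmetric] m_def[symmetric])
  have z2: "(\<Sum>y\<in>UNIV. v i y * (z i y)\<^sup>2) \<le> (\<Sum>y\<in>UNIV. v i y * (Z i y)\<^sup>2)" if "i < n" for i
  proof -
    have "(\<Sum>y\<in>UNIV. v i y * (z i y)\<^sup>2) =
        (\<Sum>y\<in>UNIV. v i y * (Z i y)\<^sup>2) - 2 * m i * (\<Sum>y\<in>UNIV. v i y * Z i y) + (m i)\<^sup>2 * (\<Sum>y\<in>UNIV. v i y)"
      by (simp add: z_def sum_distrib_left sum.distrib[symmetric] sum_subtractf[symmetric]
          algebra_simps power2_eq_square)
    then show ?thesis
      using v(1)[OF that] by (simp add: m_def[symmetric] power2_eq_square)
  qed
  have "t\<^sup>2 * (\<Sum>ys | length ys = n \<and> (\<Sum>i<n. Z i (ys ! i)) > D + t. ?p ys) \<le>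
      (\<Sum>ys | length ys = n \<and> (\<Sum>i<n. Z i (ys ! i)) > D + t. ?p ys * (\<Sum>i<n. z i (ys ! i))\<^sup>2)"
    unfolding sum_distrib_left
  proof (rule sum_mono)
    fix ys assume "ys \<in> {ys. length ys = n \<and> (\<Sum>i<n. Z i (ys ! i)) > D + t}"
    then have "t \<le> (\<Sum>i<n. z i (ys ! i))"
      by (simp add: z_def sum_subtractf D m_def)
    then have "t\<^sup>2 \<le> (\<Sum>i<n. z i (ys ! i))\<^sup>2"
      using t by (intro power_mono) auto
    then show "t\<^sup>2 * ?p ys \<le> ?p ys * (\<Sum>i<n. z i (ys ! i))\<^sup>2"
      using p[of ys] by (subst mult.commute, intro mult_left_mono)
  qed
  also have "\<dots> \<le> (\<Sum>ys\<in>words n. ?p ys * (\<Sum>i<n. z i (ys ! i))\<^sup>2)"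
    by (rule sum_mono2) (auto simp: p)
  also have "\<dots> = (\<Sum>i<n. \<Sum>y\<in>UNIV. v i y * (z i y)\<^sup>2)"
    using v z0 by (intro conjunct2[OF centered_sum_moments]) auto
  also have "\<dots> \<le> \<sigma>"
    using z2 by (intro order_trans[OF sum_mono var]) auto
  finally show ?thesis
    using t by (simp add: pos_le_divide_eq mult.commute)
qed

text \<open>Under \<open>v\<close> each of three sets has mass at most 1/4: the words atypical for
  \<open>w\<close>, those atypical for \<open>q\<close> (both by Chebyshev, hence
  \<open>4 * \<sigma> \<le> t\<^sup>2\<close>), and the typical words decoded to \<open>m\<close>
  (by comparison with \<open>q\<close> and \<open>small\<close>). So typical words not decoded to
  \<open>m\<close> carry mass at least 1/4 under \<open>v\<close>, and passing to \<open>w\<close>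
  costs a factor \<open>exp (F + t)\<close>.\<close>

lemma change_of_measure:
  fixes v w q :: "nat \<Rightarrow> 'a::finite \<Rightarrow> real"
  assumes v: "\<And>i. i < n \<Longrightarrow> (\<Sum>y\<in>UNIV. v i y) = 1" "\<And>i y. v i y > 0"
    and w: "\<And>i y. w i y > 0" and q: "\<And>i y. q i y > 0"
    and var: "(\<Sum>i<n. \<Sum>y\<in>UNIV. v i y * (ln (v i y / w i y))\<^sup>2) \<le> \<sigma>"
      "(\<Sum>i<n. \<Sum>y\<in>UNIV. v i y * (ln (v i y / q i y))\<^sup>2) \<le> \<sigma>"
    and F: "(\<Sum>i<n. \<Sum>y\<in>UNIV. v i y * ln (v i y / w i y)) \<le> F"
    and H: "(\<Sum>i<n. \<Sum>y\<in>UNIV. v i y * ln (v i y / q i y)) \<le> H"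
    and t: "0 < t" "4 * \<sigma> \<le> t\<^sup>2"
    and small: "exp (H + t) * (\<Sum>ys | length ys = n \<and> dec ys = m. \<Prod>i<n. q i (ys ! i)) \<le> 1 / 4"
  shows "exp (- (F + t)) / 4 \<le> (\<Sum>ys | length ys = n \<and> dec ys \<noteq> m. \<Prod>i<n. w i (ys ! i))"
proof -
  define P where "P v S = (\<Sum>ys\<in>S. \<Prod>i<n. v i (ys ! i))" for v :: "nat \<Rightarrow> 'a \<Rightarrow> real" and S
  define B where "B u c = {ys :: 'a list. length ys = n \<and> (\<Sum>i<n. ln (v i (ys ! i) / u i (ys ! i))) > c + t}" for u c
  have fin: "finite S" if "S \<subseteq> words n" for S :: "'a list set"
    using that finite_subset finite_words by blast
  have nn: "(\<Prod>i<n. v i (ys ! i)) \<ge> 0" for ys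
    by (simp add: prod_nonneg v less_imp_le)
  have Bsub: "B u c \<subseteq> words n" for u c
    by (auto simp: B_def)
  have cheb: "P v (B u c) \<le> 1 / 4"
    if "(\<Sum>i<n. \<Sum>y\<in>UNIV. v i y * (ln (v i y / u i y))\<^sup>2) \<le> \<sigma>"
      "(\<Sum>i<n. \<Sum>y\<in>UNIV. v i y * ln (v i y / u i y)) \<le> c" for u c
  proof -
    let ?D = "\<Sum>i<n. \<Sum>y\<in>UNIV. v i y * ln (v i y / u i y)"
    \<comment> \<open>Chebyshev is stated for the exact mean \<open>?D\<close>; a larger threshold
      \<open>c\<close> only shrinks the set.\<close>
    have "P v (B u c) \<le> P v (B u ?D)"
      unfolding P_def by (rule sum_mono2) (use that(2) nn in \<open>auto simp: fin[OF Bsub] B_def\<close>)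
    also have "\<dots> \<le> \<sigma> / t\<^sup>2"
      unfolding P_def B_def
      by (rule Chebyshev_words[OF v(1) _ refl that(1)]) (use v t in \<open>auto simp: less_imp_le\<close>)
    also have "\<dots> \<le> 1 / 4"
      using t by (simp add: field_simps)
    finally show ?thesis .
  qed
  have tilt: "(\<Prod>i<n. v i (ys ! i)) \<le> exp (c + t) * (\<Prod>i<n. u i (ys ! i))"
    if "ys \<notin> B u c" "length ys = n" "\<And>i y. u i y > 0" for ys u c
  proof -
    have "(\<Prod>i<n. v i (ys ! i)) = (\<Prod>i<n. exp (ln (v i (ys ! i) / u i (ys ! i))) * u i (ys ! i))"
      using v(2) that(3) by (intro prod.cong) (auto simp: less_imp_neq[symmetric])
    also have "\<dots> = exp (\<Sum>i<n. ln (v i (ys ! i) / u i (ys ! i))) * (\<Prod>i<n. u i (ys ! i))"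
      by (simp add: prod.distrib exp_sum)
    also have "\<dots> \<le> exp (c + t) * (\<Prod>i<n. u i (ys ! i))"
      using that by (intro mult_right_mono) (auto simp: B_def prod_nonneg less_imp_le)
    finally show ?thesis .
  qed
  define S where "S = words n - B w F - B q H"
  let ?A = "{ys. length ys = n \<and> dec ys = m}" and ?E = "{ys. length ys = n \<and> dec ys \<noteq> m}"
  have un: "P v (words n) \<le> P v (B w F) + P v (B q H) + P v (S \<inter> ?A) + P v (S \<inter> ?E)"
  proof -
    have "P v (words n) \<le> P v (((B w F \<union> B q H) \<union> (S \<inter> ?A)) \<union> (S \<inter> ?E))"
      unfolding P_def by (rule sum_mono2) (use nn in \<open>auto simp: S_def intro!: fin[of "B _ _"] Bsub\<close>)
    also have "\<dots> \<le> P v (B w F \<union> B q H) + P v (S \<inter> ?A) + P v (S \<inter> ?E)"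
      unfolding P_def using nn
      by (smt (verit, ccfv_threshold) Bsub Un_least fin S_def inf_le2 mem_Collect_eq subset_iff sum_Un sum_nonneg)
    also have "P v (B w F \<union> B q H) \<le> P v (B w F) + P v (B q H)"
      unfolding P_def using nn by (simp add: sum_Un fin[OF Bsub] sum_nonneg)
    finally show ?thesis by simp
  qed
  have one: "P v (words n) = 1"
    unfolding P_def by (simp add: sum_words_prod v)
  have bad: "P v (S \<inter> ?A) \<le> 1 / 4"
  proof -
    have "P v (S \<inter> ?A) \<le> (\<Sum>ys\<in>S \<inter> ?A. exp (H + t) * (\<Prod>i<n. q i (ys ! i)))"
      unfolding P_def by (rule sum_mono) (use tilt[where u = q and c = H, OF _ _ q] in \<open>auto simp: S_def\<close>)
    also have "\<dots> \<le> (\<Sum>ys\<in>?A. exp (H + t) * (\<Prod>i<n. q i (ys ! i)))"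
      by (rule sum_mono2) (auto intro!: fin mult_nonneg_nonneg prod_nonneg simp: q less_imp_le)
    finally show ?thesis
      using small by (simp add: sum_distrib_left)
  qed
  have "P v (S \<inter> ?E) \<le> (\<Sum>ys\<in>S \<inter> ?E. exp (F + t) * (\<Prod>i<n. w i (ys ! i)))"
    unfolding P_def by (rule sum_mono) (use tilt[where u = w and c = F, OF _ _ w] in \<open>auto simp: S_def\<close>)
  also have "\<dots> \<le> (\<Sum>ys\<in>?E. exp (F + t) * (\<Prod>i<n. w i (ys ! i)))"
    by (rule sum_mono2) (auto intro!: fin mult_nonneg_nonneg prod_nonneg simp: w less_imp_le)
  also have "\<dots> = exp (F + t) * (\<Sum>ys\<in>?E. \<Prod>i<n. w i (ys ! i))"
    by (simp add: sum_distrib_left)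
  finally have "1 / 4 \<le> exp (F + t) * (\<Sum>ys\<in>?E. \<Prod>i<n. w i (ys ! i))"
    using un one bad cheb[OF var(1) F] cheb[OF var(2) H] by linarith
  then have "exp (- (F + t)) * (1 / 4) \<le> exp (- (F + t)) * (exp (F + t) * (\<Sum>ys\<in>?E. \<Prod>i<n. w i (ys ! i)))"
    by (rule mult_left_mono) simp
  then show ?thesis
    by (simp only: mult.assoc[symmetric] exp_add[symmetric]) simp
qed

section \<open>Supermultiplicativity\<close>

lemma convex_on_second_derivative_pos:
  fixes f :: "real \<Rightarrow> real"
  assumes "\<And>x. x > 0 \<Longrightarrow> (f has_real_derivative f' x) (at x)"
    and "\<And>x. x > 0 \<Longrightarrow> (f' has_real_derivative f'' x) (at x)"
    and "\<And>x. x > 0 \<Longrightarrow> f'' x \<ge> 0"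
  shows "convex_on {0<..} f"
  using assms by (intro f''_ge0_imp_convex[where f' = f' and f'' = f'']) auto

text \<open>Likelihood ratios have mean one, so Jensen is needed only at the point 1, where the
  functions it is applied to vanish because \<open>f 1 = 1\<close>.\<close>

lemma Jensen_mean_one:
  fixes X w \<phi> :: "_ \<Rightarrow> real"
  assumes "finite A" "\<And>i. i \<in> A \<Longrightarrow> w i \<ge> 0" "(\<Sum>i\<in>A. w i) = 1"
    and "\<And>i. i \<in> A \<Longrightarrow> X i > 0" "(\<Sum>i\<in>A. w i * X i) = 1" and "convex_on {0<..} \<phi>"
  shows "\<phi> 1 \<le> (\<Sum>i\<in>A. w i * \<phi> (X i))"
proof -
  have "A \<noteq> {}"
    using assms(3) by auto
  then have "\<phi> (\<Sum>i\<in>A. w i *\<^sub>R X i) \<le> (\<Sum>i\<in>A. w i * \<phi> (X i))"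
    using assms by (intro convex_on_sum) auto
  then show ?thesis
    using assms(5) by simp
qed

(* The mixed derivative d_x^2 d_y^2 (f (x y) - f x f y) is nonnegative by the inequality for g, so
   Jensen can be applied first in y and then in x. *)
lemma mean_supermultiplicative:
  fixes f f' f'' g g' g'' :: "real \<Rightarrow> real"
  assumes f: "\<And>x. x > 0 \<Longrightarrow> (f has_real_derivative f' x) (at x)"
      "\<And>x. x > 0 \<Longrightarrow> (f' has_real_derivative f'' x) (at x)" "f 1 = 1"
    and g: "\<And>x. x > 0 \<Longrightarrow> g x = - (x\<^sup>2) * f'' x"
      "\<And>x. x > 0 \<Longrightarrow> (g has_real_derivative g' x) (at x)"
      "\<And>x. x > 0 \<Longrightarrow> (g' has_real_derivative g'' x) (at x)"
    and ineq: "\<And>x \<alpha>. x > 0 \<Longrightarrow> \<alpha> > 0 \<Longrightarrow> x\<^sup>2 * g'' x + g \<alpha> * g (x / \<alpha>) \<le> 0"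
    and A: "finite A" "\<And>i. i \<in> A \<Longrightarrow> u i \<ge> 0" "(\<Sum>i\<in>A. u i) = 1"
      "\<And>i. i \<in> A \<Longrightarrow> X i > 0" "(\<Sum>i\<in>A. u i * X i) = 1"
    and B: "finite B" "\<And>j. j \<in> B \<Longrightarrow> v j \<ge> 0" "(\<Sum>j\<in>B. v j) = 1"
      "\<And>j. j \<in> B \<Longrightarrow> Y j > 0" "(\<Sum>j\<in>B. v j * Y j) = 1"
  shows "(\<Sum>i\<in>A. u i * f (X i)) * (\<Sum>j\<in>B. v j * f (Y j)) \<le>
    (\<Sum>i\<in>A. \<Sum>j\<in>B. u i * v j * f (X i * Y j))"
proof -
  have inner: "0 \<le> (\<Sum>j\<in>B. v j * (g x * f (Y j) - g (x * Y j)))" if x: "x > 0" for x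
  proof -
    have "convex_on {0<..} (\<lambda>y. g x * f y - g (x * y))"
    proof (rule convex_on_second_derivative_pos)
      fix y :: real assume y: "y > 0"
      have xy: "x * y > 0" using x y by simp
      have g1: "((\<lambda>y. g (x * y)) has_real_derivative g' (x * y) * x) (at y)"
        by (rule DERIV_chain2[where f = g and g = "\<lambda>y. x * y", OF g(2)[OF xy]]) (auto intro!: derivative_eq_intros)
      have g2: "((\<lambda>y. g' (x * y)) has_real_derivative g'' (x * y) * x) (at y)"
        by (rule DERIV_chain2[where f = g' and g = "\<lambda>y. x * y", OF g(3)[OF xy]]) (auto intro!: derivative_eq_intros)
      show "((\<lambda>y. g x * f y - g (x * y)) has_real_derivative (g x * f' y - x * g' (x * y))) (at y)"
        using DERIV_diff[OF DERIV_cmult[OF f(1)[OF y], of "g x"] g1] by (simp add: mult.commute)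
      show "((\<lambda>y. g x * f' y - x * g' (x * y)) has_real_derivative
          (g x * f'' y - x\<^sup>2 * g'' (x * y))) (at y)"
        using DERIV_diff[OF DERIV_cmult[OF f(2)[OF y], of "g x"] DERIV_cmult[OF g2, of x]]
        by (simp add: power2_eq_square mult_ac)
      \<comment> \<open>Since \<open>y\<^sup>2 * f'' y = - g y\<close>, this is minus the left side
        of \<open>ineq\<close> at the point \<open>x * y\<close> with \<alpha> equal to
        \<open>x\<close>.\<close>
      have "y\<^sup>2 * (g x * f'' y - x\<^sup>2 * g'' (x * y)) = - ((x * y)\<^sup>2 * g'' (x * y) + g x * g (x * y / x))"
        using x y by (simp add: g(1)[OF y] algebra_simps power_mult_distrib)
      also have "\<dots> \<ge> 0"
        using ineq[OF xy x] by simp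
      finally show "g x * f'' y - x\<^sup>2 * g'' (x * y) \<ge> 0"
        using y by (simp add: zero_le_mult_iff)
    qed
    from Jensen_mean_one[OF B this] show ?thesis
      using f(3) by simp
  qed
  have "convex_on {0<..} (\<lambda>x. \<Sum>j\<in>B. v j * (f (x * Y j) - f x * f (Y j)))"
  proof (rule convex_on_second_derivative_pos)
    fix x :: real assume x: "x > 0"
    have xy: "x * Y j > 0" if "j \<in> B" for j using x B(4)[OF that] by simp
    have f1: "((\<lambda>x. f (x * Y j)) has_real_derivative f' (x * Y j) * Y j) (at x)" if "j \<in> B" for j
      by (rule DERIV_chain2[where f = f and g = "\<lambda>x. x * Y j", OF f(1)[OF xy[OF that]]]) (auto intro!: derivative_eq_intros)
    have f2: "((\<lambda>x. f' (x * Y j)) has_real_derivative f'' (x * Y j) * Y j) (at x)" if "j \<in> B" for j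
      by (rule DERIV_chain2[where f = f' and g = "\<lambda>x. x * Y j", OF f(2)[OF xy[OF that]]]) (auto intro!: derivative_eq_intros)
    show "((\<lambda>x. \<Sum>j\<in>B. v j * (f (x * Y j) - f x * f (Y j))) has_real_derivative
        (\<Sum>j\<in>B. v j * (f' (x * Y j) * Y j - f' x * f (Y j)))) (at x)"
      by (rule DERIV_sum, rule DERIV_cmult, rule DERIV_diff, erule f1, rule DERIV_cmult_right, rule f(1)[OF x])
    show "((\<lambda>x. \<Sum>j\<in>B. v j * (f' (x * Y j) * Y j - f' x * f (Y j))) has_real_derivative
        (\<Sum>j\<in>B. v j * (f'' (x * Y j) * Y j * Y j - f'' x * f (Y j)))) (at x)"
      by (rule DERIV_sum, rule DERIV_cmult, rule DERIV_diff, rule DERIV_cmult_right, erule f2,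
          rule DERIV_cmult_right, rule f(2)[OF x])
    \<comment> \<open>After multiplication by \<open>x\<^sup>2\<close> the second derivative of the
      outer function is exactly the sum that the Jensen step in \<open>y\<close> has shown to be
      nonnegative.\<close>
    have "x\<^sup>2 * (\<Sum>j\<in>B. v j * (f'' (x * Y j) * Y j * Y j - f'' x * f (Y j))) =
        (\<Sum>j\<in>B. v j * (g x * f (Y j) - g (x * Y j)))"
      unfolding sum_distrib_left
    proof (rule sum.cong)
      fix j assume "j \<in> B"
      show "x\<^sup>2 * (v j * (f'' (x * Y j) * Y j * Y j - f'' x * f (Y j))) =
          v j * (g x * f (Y j) - g (x * Y j))"
        unfolding g(1)[OF x] g(1)[OF xy[OF \<open>j \<in> B\<close>]] by algebra
    qed simp
    with inner[OF x] have "0 \<le> x\<^sup>2 * (\<Sum>j\<in>B. v j * (f'' (x * Y j) * Y j * Y j - f'' x * f (Y j)))"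
      by (simp only:)
    then show "0 \<le> (\<Sum>j\<in>B. v j * (f'' (x * Y j) * Y j * Y j - f'' x * f (Y j)))"
      using x by (simp add: zero_le_mult_iff)
  qed
  from Jensen_mean_one[OF A this]
  have "0 \<le> (\<Sum>i\<in>A. u i * (\<Sum>j\<in>B. v j * (f (X i * Y j) - f (X i) * f (Y j))))"
    by (simp add: f(3))
  also have "\<dots> = (\<Sum>i\<in>A. \<Sum>j\<in>B. u i * v j * f (X i * Y j)) -
      (\<Sum>i\<in>A. u i * f (X i)) * (\<Sum>j\<in>B. v j * f (Y j))"
    unfolding sum_product by (simp add: sum_distrib_left sum_subtractf algebra_simps)
  finally show ?thesis by simp
qed

text \<open>Tensor power argument: the product of \<open>n\<close> independent ratios is again a
  mean-one variable, on words, so induction gives \<open>c ^ n \<le> b * d ^ n\<close>. As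
  \<open>n\<close> is arbitrary and powers of a number above 1 are unbounded, the constant
  \<open>b\<close> disappears and \<open>c \<le> d\<close> remains.\<close>

lemma mean_le_mean_powr:
  fixes f f' f'' g g' g'' :: "real \<Rightarrow> real" and u X :: "'a::finite \<Rightarrow> real"
  assumes f: "\<And>x. x > 0 \<Longrightarrow> (f has_real_derivative f' x) (at x)"
      "\<And>x. x > 0 \<Longrightarrow> (f' has_real_derivative f'' x) (at x)" "f 1 = 1"
    and g: "\<And>x. x > 0 \<Longrightarrow> g x = - (x\<^sup>2) * f'' x"
      "\<And>x. x > 0 \<Longrightarrow> (g has_real_derivative g' x) (at x)"
      "\<And>x. x > 0 \<Longrightarrow> (g' has_real_derivative g'' x) (at x)"
    and ineq: "\<And>x \<alpha>. x > 0 \<Longrightarrow> \<alpha> > 0 \<Longrightarrow> x\<^sup>2 * g'' x + g \<alpha> * g (x / \<alpha>) \<le> 0"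
    and bound: "\<And>x. x > 0 \<Longrightarrow> 0 \<le> f x" "\<And>x. x > 0 \<Longrightarrow> f x \<le> b * x powr s"
    and u: "\<And>i. u i > 0" "(\<Sum>i\<in>UNIV. u i) = 1"
    and X: "\<And>i. X i > 0" "(\<Sum>i\<in>UNIV. u i * X i) = 1"
  shows "(\<Sum>i\<in>UNIV. u i * f (X i)) \<le> (\<Sum>i\<in>UNIV. u i * X i powr s)"
proof -
  define c where "c = (\<Sum>i\<in>UNIV. u i * f (X i))"
  define d where "d = (\<Sum>i\<in>UNIV. u i * X i powr s)"
  have c: "c \<ge> 0"
    unfolding c_def by (intro sum_nonneg mult_nonneg_nonneg) (auto simp: u X bound less_imp_le)
  have d: "d > 0"
    unfolding d_def using u(1) X(1) by (intro sum_pos mult_pos_pos) (auto simp: less_imp_neq[symmetric])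
  let ?u = "\<lambda>n ys. \<Prod>i<n. u (ys ! i)" and ?X = "\<lambda>n ys. \<Prod>i<n. X (ys ! i)"
  have low: "c ^ n \<le> (\<Sum>ys\<in>words n. ?u n ys * f (?X n ys))" for n
  proof (induction n)
    case (Suc n)
    have "c ^ Suc n \<le> c * (\<Sum>ys\<in>words n. ?u n ys * f (?X n ys))"
      using Suc c by (simp add: mult_left_mono)
    also have "\<dots> \<le> (\<Sum>i\<in>UNIV. \<Sum>ys\<in>words n. u i * ?u n ys * f (X i * ?X n ys))"
      unfolding c_def
    proof (rule mean_supermultiplicative[OF f g ineq])
      show "(\<Sum>ys\<in>words n. ?u n ys) = 1"
        using sum_words_prod[of "\<lambda>_. u" n] u by simp
      show "(\<Sum>ys\<in>words n. ?u n ys * ?X n ys) = 1"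
        using sum_words_prod[of "\<lambda>_ i. u i * X i" n] X by (simp add: prod.distrib)
    qed (auto simp: u X less_imp_le intro: prod_nonneg prod_pos)
    also have "\<dots> = (\<Sum>ys\<in>words (Suc n). ?u (Suc n) ys * f (?X (Suc n) ys))"
      unfolding sum_words_Suc prod_Cons_nth[of "\<lambda>_. u"] prod_Cons_nth[of "\<lambda>_. X"] by simp
    finally show ?case .
  qed (simp add: f)
  have up: "(\<Sum>ys\<in>words n. ?u n ys * f (?X n ys)) \<le> b * d ^ n" for n
  proof -
    have "(\<Sum>ys\<in>words n. ?u n ys * f (?X n ys)) \<le> (\<Sum>ys\<in>words n. b * (\<Prod>i<n. u (ys ! i) * X (ys ! i) powr s))"
    proof (rule sum_mono)
      fix ys :: "'a list"
      have "?u n ys * f (?X n ys) \<le> ?u n ys * (b * (?X n ys) powr s)"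
        by (intro mult_left_mono bound prod_nonneg prod_pos) (auto simp: u X less_imp_le)
      also have "(?X n ys) powr s = (\<Prod>i<n. X (ys ! i) powr s)"
        by (simp add: prod_powr_distrib X less_imp_le)
      finally show "?u n ys * f (?X n ys) \<le> b * (\<Prod>i<n. u (ys ! i) * X (ys ! i) powr s)"
        by (simp add: prod.distrib mult_ac)
    qed
    also have "\<dots> = b * d ^ n"
      using sum_words_prod[of "\<lambda>_ i. u i * X i powr s" n] by (simp add: sum_distrib_left[symmetric] d_def)
    finally show ?thesis .
  qed
  have "(c / d) ^ n \<le> b" for n
    using order_trans[OF low up, of n] d by (simp add: power_divide divide_le_eq)
  moreover have "\<exists>n. b < (c / d) ^ n" if "c / d > 1"
    using real_arch_pow[OF that] by blast
  ultimately have "c / d \<le> 1"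
    by (meson not_le)
  then show ?thesis
    using d by (simp add: c_def d_def)
qed

section \<open>Duality for the sphere packing exponent\<close>

definition kl :: "('a::finite \<Rightarrow> real) \<Rightarrow> ('a \<Rightarrow> real) \<Rightarrow> real" where
  "kl u v = (\<Sum>y\<in>UNIV. u y * ln (u y / v y))"

text \<open>Strict positivity is built in so that every logarithm of a ratio is genuine; convex
  combinations and geometric mixtures of positive laws remain positive.\<close>

definition stoch :: "('x \<Rightarrow> 'y::finite \<Rightarrow> real) \<Rightarrow> bool" where
  "stoch V \<longleftrightarrow> (\<forall>x y. V x y > 0) \<and> (\<forall>x. (\<Sum>y\<in>UNIV. V x y) = 1)"

definition output_law :: "'x::finite pmf \<Rightarrow> ('x \<Rightarrow> 'y \<Rightarrow> real) \<Rightarrow> 'y \<Rightarrow> real" where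
  "output_law p V y = (\<Sum>x\<in>UNIV. pmf p x * V x y)"

text \<open>With \<open>U\<close> constantly equal to \<open>output_law p V\<close> this is the
  mutual information of input law \<open>p\<close> and channel \<open>V\<close>.\<close>

definition cond_kl :: "'x::finite pmf \<Rightarrow> ('x \<Rightarrow> 'y::finite \<Rightarrow> real) \<Rightarrow> ('x \<Rightarrow> 'y \<Rightarrow> real) \<Rightarrow> real" where
  "cond_kl p V U = (\<Sum>x\<in>UNIV. pmf p x * kl (V x) (U x))"

lemma sum_pmf_UNIV: "(\<Sum>x\<in>UNIV. pmf p x) = 1" for p :: "'a::finite pmf"
  by (simp add: sum_pmf_eq_1)

lemma output_law_pos:
  assumes "\<And>x. V x y > 0"
  shows "output_law p V y > 0"
proof -
  obtain x where "pmf p x > 0"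
    using set_pmf_not_empty[of p] by (auto simp: pmf_positive_iff)
  then have "0 < pmf p x * V x y"
    using assms by simp
  also have "\<dots> \<le> output_law p V y"
    unfolding output_law_def
    by (rule member_le_sum) (auto simp: assms less_imp_le)
  finally show ?thesis .
qed

lemma sum_output_law:
  assumes "stoch V"
  shows "(\<Sum>y\<in>UNIV. output_law p V y) = 1"
proof -
  have "(\<Sum>y\<in>UNIV. output_law p V y) = (\<Sum>x\<in>UNIV. pmf p x * (\<Sum>y\<in>UNIV. V x y))"
    unfolding output_law_def by (subst sum.swap) (simp add: sum_distrib_left)
  then show ?thesis
    using assms by (simp add: stoch_def sum_pmf_UNIV)
qed

section \<open>Convexity of divergence and of mutual information\<close>

text \<open>Each summand on the right is bounded by \<open>ln r \<le> r - 1\<close>, with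
  \<open>r\<close> the quotient of the pooled ratio \<open>(a + c) / (b + d)\<close> by the
  individual one; the linear remainders of the two bounds add up to 0.\<close>

lemma log_sum_ineq:
  fixes a b c d :: real
  assumes "a > 0" "b > 0" "c > 0" "d > 0"
  shows "(a + c) * ln ((a + c) / (b + d)) \<le> a * ln (a / b) + c * ln (c / d)"
proof -
  have *: "a - b * (a + c) / (b + d) \<le> a * ln (a / b) - a * ln ((a + c) / (b + d))"
    if "a > 0" "b > 0" "c > 0" "d > 0" for a b c d :: real
  proof -
    define r where "r = (b * (a + c)) / (a * (b + d))"
    have r: "r > 0"
      using that by (simp add: r_def)
    have "ln (a / b) - ln ((a + c) / (b + d)) = - ln r"
      using that by (simp add: r_def ln_div ln_mult)
    also have "\<dots> \<ge> 1 - r"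
      using ln_le_minus_one[OF r] by simp
    finally have "a * (1 - r) \<le> a * (ln (a / b) - ln ((a + c) / (b + d)))"
      using that by (intro mult_left_mono) auto
    moreover have "a * r = b * (a + c) / (b + d)"
      using that by (simp add: r_def)
    ultimately show ?thesis
      by (simp add: right_diff_distrib)
  qed
  have "b * (a + c) / (b + d) + d * (c + a) / (d + b) = a + c"
    using assms by (simp add: add.commute add_divide_distrib[symmetric] distrib_right[symmetric])
  then show ?thesis
    using *[of a b c d] *[of c d a b] assms by (simp add: add.commute distrib_right)
qed

lemma log_sum_convex:
  fixes a b c d :: real
  assumes "a > 0" "b > 0" "c > 0" "d > 0" "\<alpha> \<ge> 0" "\<beta> \<ge> 0"
  shows "(\<alpha> * a + \<beta> * c) * ln ((\<alpha> * a + \<beta> * c) / (\<alpha> * b + \<beta> * d)) \<le>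
    \<alpha> * (a * ln (a / b)) + \<beta> * (c * ln (c / d))"
proof (cases "\<alpha> = 0 \<or> \<beta> = 0")
  case False
  then show ?thesis
    using log_sum_ineq[of "\<alpha> * a" "\<alpha> * b" "\<beta> * c" "\<beta> * d"] assms by (simp add: mult.assoc)
qed (use assms in auto)

lemma kl_convex:
  assumes "\<And>y. u y > 0" "\<And>y. v y > 0" "\<And>y. u' y > 0" "\<And>y. v' y > 0" "\<alpha> \<ge> 0" "\<beta> \<ge> 0"
  shows "kl (\<lambda>y. \<alpha> * u y + \<beta> * u' y) (\<lambda>y. \<alpha> * v y + \<beta> * v' y) \<le> \<alpha> * kl u v + \<beta> * kl u' v'"
  unfolding kl_def sum_distrib_left sum.distrib[symmetric]
  by (intro sum_mono log_sum_convex assms)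

text \<open>Joint convexity is what makes mutual information convex in the channel: there the second
  argument, the output law, moves with \<open>V\<close>.\<close>

lemma cond_kl_convex:
  assumes "\<And>x y. V x y > 0" "\<And>x y. U x y > 0" "\<And>x y. V' x y > 0" "\<And>x y. U' x y > 0"
    and "\<alpha> \<ge> 0" "\<beta> \<ge> 0"
  shows "cond_kl p (\<lambda>x y. \<alpha> * V x y + \<beta> * V' x y) (\<lambda>x y. \<alpha> * U x y + \<beta> * U' x y) \<le>
    \<alpha> * cond_kl p V U + \<beta> * cond_kl p V' U'"
proof -
  have "cond_kl p (\<lambda>x y. \<alpha> * V x y + \<beta> * V' x y) (\<lambda>x y. \<alpha> * U x y + \<beta> * U' x y) \<le>
      (\<Sum>x\<in>UNIV. pmf p x * (\<alpha> * kl (V x) (U x) + \<beta> * kl (V' x) (U' x)))"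
    unfolding cond_kl_def by (intro sum_mono mult_left_mono kl_convex assms) auto
  also have "\<dots> = \<alpha> * cond_kl p V U + \<beta> * cond_kl p V' U'"
    by (simp add: cond_kl_def sum_distrib_left sum.distrib algebra_simps)
  finally show ?thesis .
qed

lemma kl_nonneg:
  assumes "\<And>y. u y > 0" "\<And>y. v y > 0" "(\<Sum>y\<in>UNIV. u y) = 1" "(\<Sum>y\<in>UNIV. v y) = 1"
  shows "kl u v \<ge> 0"
proof -
  have "u y - v y \<le> u y * ln (u y / v y)" for y
  proof -
    have "ln (v y / u y) \<le> v y / u y - 1"
      using assms by (intro ln_le_minus_one) simp
    moreover have "ln (u y / v y) = - ln (v y / u y)"
      using assms(1,2)[of y] by (simp add: ln_div)
    ultimately have "u y * (1 - v y / u y) \<le> u y * ln (u y / v y)"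
      using assms(1)[of y] by (intro mult_left_mono) auto
    then show ?thesis
      using assms(1)[of y] by (simp add: right_diff_distrib)
  qed
  then have "(\<Sum>y\<in>UNIV. u y - v y) \<le> kl u v"
    unfolding kl_def by (rule sum_mono)
  then show ?thesis
    using assms by (simp add: sum_subtractf)
qed

text \<open>The difference of the two sides is the divergence of the output law from
  \<open>q\<close>. Thus mutual information is a minimum over \<open>q\<close>, which lets the dual
  problem range over arbitrary output laws.\<close>

lemma cond_kl_output_law_le:
  assumes "stoch V" "\<And>y. q y > 0" "(\<Sum>y\<in>UNIV. q y) = 1"
  shows "cond_kl p V (\<lambda>_. output_law p V) \<le> cond_kl p V (\<lambda>_. q)"
proof -
  have V: "V x y > 0" for x y
    using assms(1) by (simp add: stoch_def)
  have r: "output_law p V y > 0" for y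
    using V by (intro output_law_pos)
  have "cond_kl p V (\<lambda>_. q) - cond_kl p V (\<lambda>_. output_law p V) =
      (\<Sum>x\<in>UNIV. \<Sum>y\<in>UNIV. pmf p x * V x y * ln (output_law p V y / q y))"
    unfolding cond_kl_def kl_def sum_distrib_left sum_subtractf[symmetric]
  proof (intro sum.cong refl)
    fix x y
    show "pmf p x * (V x y * ln (V x y / q y)) - pmf p x * (V x y * ln (V x y / output_law p V y)) =
        pmf p x * V x y * ln (output_law p V y / q y)"
      using V[of x y] r[of y] assms(2)[of y] by (simp add: ln_div algebra_simps)
  qed
  also have "\<dots> = kl (output_law p V) q"
    unfolding kl_def by (subst sum.swap) (simp add: output_law_def sum_distrib_right)
  also have "\<dots> \<ge> 0"
    using assms r sum_output_law by (intro kl_nonneg) auto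
  finally show ?thesis by simp
qed

section \<open>Lagrangian duality for the auxiliary channel\<close>

text \<open>A line in the plane separates the pairs dominating some \<open>(F V, H V)\<close> from
  the pairs with first entry below \<open>c\<close> and second at most 0; its slope is the
  multiplier. Condition \<open>comb\<close> asks only for a point dominated by the convex
  combination of values, so \<open>D\<close> needs no linear structure.\<close>

lemma convex_Lagrange_multiplier:
  fixes F H :: "'a \<Rightarrow> real"
  assumes comb: "\<And>V V' \<alpha> \<beta>. V \<in> D \<Longrightarrow> V' \<in> D \<Longrightarrow> \<alpha> \<ge> 0 \<Longrightarrow> \<beta> \<ge> 0 \<Longrightarrow> \<alpha> + \<beta> = 1 \<Longrightarrow>
      \<exists>U\<in>D. F U \<le> \<alpha> * F V + \<beta> * F V' \<and> H U \<le> \<alpha> * H V + \<beta> * H V'"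
    and slater: "V0 \<in> D" "H V0 < 0"
    and feasible: "\<And>V. V \<in> D \<Longrightarrow> H V \<le> 0 \<Longrightarrow> c \<le> F V"
  obtains \<rho> where "\<rho> \<ge> 0" "\<And>V. V \<in> D \<Longrightarrow> c \<le> F V + \<rho> * H V"
proof -
  define S where "S = {(u, v). \<exists>V\<in>D. F V \<le> u \<and> H V \<le> v}"
  define T where "T = {(u, v). u < c \<and> v \<le> (0::real)}"
  have "convex S"
  proof (rule convexI)
    fix x y :: "real \<times> real" and \<alpha> \<beta> :: real
    assume "x \<in> S" "y \<in> S" and ab: "\<alpha> \<ge> 0" "\<beta> \<ge> 0" "\<alpha> + \<beta> = 1"
    then obtain V V' where V: "V \<in> D" "F V \<le> fst x" "H V \<le> snd x"
      and V': "V' \<in> D" "F V' \<le> fst y" "H V' \<le> snd y"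
      by (auto simp: S_def)
    obtain U where U: "U \<in> D" "F U \<le> \<alpha> * F V + \<beta> * F V'" "H U \<le> \<alpha> * H V + \<beta> * H V'"
      using comb[OF V(1) V'(1) ab] by blast
    have "F U \<le> \<alpha> * fst x + \<beta> * fst y" "H U \<le> \<alpha> * snd x + \<beta> * snd y"
      using U V V' ab by (smt (verit) mult_left_mono)+
    with U(1) show "\<alpha> *\<^sub>R x + \<beta> *\<^sub>R y \<in> S"
      by (auto simp: S_def case_prod_beta)
  qed
  moreover have "convex T"
  proof -
    have "T = {..<c} \<times> {..0}"
      by (auto simp: T_def)
    then show ?thesis
      by (simp add: convex_Times)
  qed
  moreover have "(F V0, H V0) \<in> S" "(c - 1, 0) \<in> T"
    using slater by (auto simp: S_def T_def)
  moreover have "S \<inter> T = {}"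
    using feasible by (force simp: S_def T_def)
  ultimately obtain a :: "real \<times> real" and b where a: "a \<noteq> 0"
    and S: "\<And>x. x \<in> S \<Longrightarrow> inner a x \<le> b" and T: "\<And>x. x \<in> T \<Longrightarrow> inner a x \<ge> b"
    using separating_hyperplane_sets[of S T] by (metis empty_iff)
  obtain \<alpha> \<beta> where ab: "a = (\<alpha>, \<beta>)"
    by fastforce
  have S': "\<alpha> * u + \<beta> * v \<le> b" if "V \<in> D" "F V \<le> u" "H V \<le> v" for V u v
    using S[of "(u, v)"] that by (auto simp: S_def ab)
  have T': "\<alpha> * u \<ge> b" if "u < c" for u
    using T[of "(u, 0)"] that by (auto simp: T_def ab)
  \<comment> \<open>\<open>S\<close> is upward closed in both coordinates, so a positive coefficient
    would let the functional exceed \<open>b\<close>; \<open>t\<close> is chosen to overshoot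
    \<open>b\<close> by at least that coefficient.\<close>
  have \<alpha>: "\<alpha> \<le> 0"
  proof (rule ccontr)
    assume "\<not> \<alpha> \<le> 0"
    define t where "t = max 0 ((b - \<alpha> * F V0 - \<beta> * H V0) / \<alpha> + 1)"
    have "\<alpha> * (F V0 + t) + \<beta> * H V0 \<le> b"
      using S'[OF slater(1), of "F V0 + t" "H V0"] by (simp add: t_def)
    moreover have "\<alpha> * t \<ge> \<alpha> * ((b - \<alpha> * F V0 - \<beta> * H V0) / \<alpha> + 1)"
      using \<open>\<not> \<alpha> \<le> 0\<close> by (intro mult_left_mono) (auto simp: t_def)
    moreover have "\<alpha> * ((b - \<alpha> * F V0 - \<beta> * H V0) / \<alpha> + 1) = (b - \<alpha> * F V0 - \<beta> * H V0) + \<alpha>"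
      using \<open>\<not> \<alpha> \<le> 0\<close> by (simp add: distrib_left)
    ultimately show False
      using \<open>\<not> \<alpha> \<le> 0\<close> unfolding distrib_left[of \<alpha> "F V0" t] by linarith
  qed
  have \<beta>: "\<beta> \<le> 0"
  proof (rule ccontr)
    assume "\<not> \<beta> \<le> 0"
    define t where "t = max 0 ((b - \<alpha> * F V0 - \<beta> * H V0) / \<beta> + 1)"
    have "\<alpha> * F V0 + \<beta> * (H V0 + t) \<le> b"
      using S'[OF slater(1), of "F V0" "H V0 + t"] by (simp add: t_def)
    moreover have "\<beta> * t \<ge> \<beta> * ((b - \<alpha> * F V0 - \<beta> * H V0) / \<beta> + 1)"
      using \<open>\<not> \<beta> \<le> 0\<close> by (intro mult_left_mono) (auto simp: t_def)
    moreover have "\<beta> * ((b - \<alpha> * F V0 - \<beta> * H V0) / \<beta> + 1) = (b - \<alpha> * F V0 - \<beta> * H V0) + \<beta>"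
      using \<open>\<not> \<beta> \<le> 0\<close> by (simp add: distrib_left)
    ultimately show False
      using \<open>\<not> \<beta> \<le> 0\<close> unfolding distrib_left[of \<beta> "H V0" t] by linarith
  qed
  \<comment> \<open>\<open>T\<close> excludes the value \<open>c\<close> itself, so it is approached
    from below; dividing \<open>e\<close> by \<open>1 - \<alpha>\<close> keeps the loss below
    \<open>e\<close>.\<close>
  have b: "b \<le> \<alpha> * c"
  proof (rule field_le_epsilon)
    fix e :: real assume e: "e > 0"
    have "b \<le> \<alpha> * (c - e / (1 - \<alpha>))"
      using e \<alpha> by (intro T') auto
    moreover have "\<alpha> * (c - e / (1 - \<alpha>)) = \<alpha> * c + e * (- \<alpha> / (1 - \<alpha>))"
      by (simp add: algebra_simps)
    moreover have "- \<alpha> / (1 - \<alpha>) \<le> 1"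
      using \<alpha> by (subst pos_divide_le_eq) auto
    then have "e * (- \<alpha> / (1 - \<alpha>)) \<le> e * 1"
      using e by (intro mult_left_mono) auto
    ultimately show "b \<le> \<alpha> * c + e" by linarith
  qed
  have sep: "\<alpha> * F V + \<beta> * H V \<le> \<alpha> * c" if "V \<in> D" for V
    using S'[OF that order_refl order_refl] b by linarith
  \<comment> \<open>The strictly feasible \<open>V0\<close> rules out a separating line that ignores
    \<open>F\<close>.\<close>
  have "\<alpha> \<noteq> 0"
  proof
    assume "\<alpha> = 0"
    then have "\<beta> < 0" "\<beta> * H V0 \<le> 0"
      using a ab \<beta> sep[OF slater(1)] by (auto simp: zero_prod_def)
    then show False
      using slater(2) by (simp add: mult_le_0_iff)
  qed
  then have \<alpha>: "\<alpha> < 0" using \<alpha> by simp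
  show thesis
  proof
    show "\<beta> / \<alpha> \<ge> 0"
      using \<alpha> \<beta> by (simp add: divide_nonpos_neg)
    fix V assume "V \<in> D"
    from sep[OF this] show "c \<le> F V + \<beta> / \<alpha> * H V"
      using \<alpha> by (simp add: field_simps)
  qed
qed

text \<open>Its negative logarithm is \<open>s\<close> times the Renyi divergence of order
  \<open>1 - s\<close> of \<open>u\<close> from \<open>q\<close>. It is also the mean under
  \<open>u\<close> of the \<open>s\<close>-th power of the ratio \<open>q / u\<close>.\<close>

definition renyi_sum :: "real \<Rightarrow> ('a::finite \<Rightarrow> real) \<Rightarrow> ('a \<Rightarrow> real) \<Rightarrow> real" where
  "renyi_sum s u q = (\<Sum>y\<in>UNIV. u y powr (1 - s) * q y powr s)"

lemma renyi_sum_pos: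
  assumes "\<And>y. u y > 0" "\<And>y. q y > 0"
  shows "renyi_sum s u q > 0"
  unfolding renyi_sum_def using assms by (intro sum_pos) (auto simp: less_imp_neq[symmetric])

(* The weighted sum of divergences is minimised over V by this geometric mixture of w and q. *)
lemma kl_geometric_mixture:
  fixes w q :: "'a::finite \<Rightarrow> real"
  assumes s: "0 < s" "s < 1" and w: "\<And>y. w y > 0" and q: "\<And>y. q y > 0"
  defines "V \<equiv> \<lambda>y. w y powr (1 - s) * q y powr s / renyi_sum s w q"
  shows "\<And>y. V y > 0" "(\<Sum>y\<in>UNIV. V y) = 1"
    and "kl V w + s / (1 - s) * kl V q = - ln (renyi_sum s w q) / (1 - s)"
proof -
  let ?Z = "renyi_sum s w q"
  have Z: "?Z > 0"
    by (rule renyi_sum_pos[OF w q])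
  show V: "V y > 0" for y
    using w[of y] q[of y] Z by (simp add: V_def)
  show one: "(\<Sum>y\<in>UNIV. V y) = 1"
    using Z by (simp add: V_def sum_divide_distrib[symmetric] renyi_sum_def[symmetric])
  have lnV: "ln (V y) = (1 - s) * ln (w y) + s * ln (q y) - ln ?Z" for y
    using w[of y] q[of y] Z by (simp add: V_def ln_div ln_mult ln_powr)
  \<comment> \<open>The exponents \<open>1 - s\<close> and \<open>s\<close> are chosen so that this
    weighted log ratio does not depend on \<open>y\<close>; averaging under \<open>V\<close> then
    returns the constant.\<close>
  have "ln (V y / w y) + s / (1 - s) * ln (V y / q y) = - ln ?Z / (1 - s)" for y
    using s V[of y] w[of y] q[of y] by (simp add: ln_div lnV field_simps)
  then have "V y * ln (V y / w y) + s / (1 - s) * (V y * ln (V y / q y)) = V y * (- ln ?Z / (1 - s))" for y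
    by (metis (no_types, opaque_lifting) distrib_left mult.left_commute)
  then have "kl V w + s / (1 - s) * kl V q = (\<Sum>y\<in>UNIV. V y) * (- ln ?Z / (1 - s))"
    unfolding kl_def sum_distrib_left sum_distrib_right sum.distrib[symmetric] by (intro sum.cong refl)
  then show "kl V w + s / (1 - s) * kl V q = - ln ?Z / (1 - s)"
    by (simp add: one)
qed

text \<open>Probabilities satisfy \<open>q y \<le> q y powr s\<close>, so the sum is at least
  \<open>exp (- L) powr (1 - s)\<close> times the total mass of \<open>q\<close>. After division by
  \<open>1 - s\<close> the bound is uniform in \<open>s\<close>.\<close>

lemma ln_renyi_sum_bound:
  assumes s: "0 < s" "s < 1" and w: "\<And>y. w y \<ge> exp (- L)"
    and q: "\<And>y. q y > 0" "(\<Sum>y\<in>UNIV. q y) = 1"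
  shows "- ln (renyi_sum s w q) \<le> (1 - s) * L"
proof -
  have q1: "q y \<le> 1" for y
    using member_le_sum[of y UNIV q] q by (auto simp: less_imp_le)
  have "exp (- (1 - s) * L) = (\<Sum>y\<in>UNIV. exp (- L) powr (1 - s) * q y)"
    unfolding sum_distrib_left[symmetric] by (simp add: q powr_def algebra_simps)
  also have "\<dots> \<le> renyi_sum s w q"
    unfolding renyi_sum_def
  proof (intro sum_mono mult_mono)
    fix y
    show "exp (- L) powr (1 - s) \<le> w y powr (1 - s)"
      using s w by (intro powr_mono2) auto
    show "q y \<le> q y powr s"
      using powr_mono'[of s 1 "q y"] s q(1)[of y] q1[of y] by simp
  qed (auto simp: q less_imp_le)
  finally have "exp (- (1 - s) * L) \<le> renyi_sum s w q" .
  then have "- (1 - s) * L \<le> ln (renyi_sum s w q)"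
    by (smt (verit) exp_gt_zero ln_exp ln_le_cancel_iff)
  then show ?thesis by (simp add: algebra_simps)
qed

(* Lagrangian duality for Haroutunian's form of the sphere packing exponent. The bound L on the dual
   value at rate 0 controls the price of lowering the rate from R to (1 - l) R. *)
lemma exists_auxiliary_channel:
  fixes p :: "'x::finite pmf" and w :: "'x \<Rightarrow> 'y::finite \<Rightarrow> real"
  assumes w: "stoch w" "\<And>x y. w x y \<ge> exp (- L)"
    and R: "R > 0" and l: "0 \<le> l" "l < 1" and E: "E \<ge> 0" and \<eta>: "\<eta> > 0"
    and dual: "\<And>s k. 0 < s \<Longrightarrow> s < 1 \<Longrightarrow>
      (\<And>q :: 'y pmf. (\<And>y. pmf q y > 0) \<Longrightarrow> k \<le> (\<Sum>x\<in>UNIV. pmf p x * - ln (renyi_sum s (w x) (pmf q)))) \<Longrightarrow>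
      k / (1 - s) - s / (1 - s) * R \<le> E"
  shows "\<exists>V. stoch V \<and> cond_kl p V (\<lambda>_. output_law p V) \<le> (1 - l) * R \<and> cond_kl p V w \<le> E + l * L + \<eta>"
proof (rule ccontr)
  assume contr: "\<not> ?thesis"
  have wpos: "w x y > 0" for x y
    using w(1) by (simp add: stoch_def)
  have L: "L \<ge> 0"
  proof -
    have "w x y \<le> 1" for x y
      using w(1) member_le_sum[of y UNIV "w x"] by (auto simp: stoch_def less_imp_le)
    then have "exp (- L) \<le> 1"
      using w(2) order_trans by blast
    then show ?thesis by simp
  qed
  \<comment> \<open>By contradiction, \<open>c\<close> bounds the divergence from \<open>w\<close>
    of every channel meeting the rate constraint. The positive \<eta> avoids having to show that the
    minimum is attained.\<close>
  define c where "c = E + l * L + \<eta>"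
  define H where "H V = cond_kl p V (\<lambda>_. output_law p V) - (1 - l) * R" for V :: "'x \<Rightarrow> 'y \<Rightarrow> real"
  have comb: "\<exists>U\<in>Collect stoch. cond_kl p U w \<le> \<alpha> * cond_kl p V w + \<beta> * cond_kl p V' w \<and>
      H U \<le> \<alpha> * H V + \<beta> * H V'"
    if "V \<in> Collect stoch" "V' \<in> Collect stoch" and ab: "\<alpha> \<ge> 0" "\<beta> \<ge> 0" "\<alpha> + \<beta> = 1" for V V' \<alpha> \<beta>
  proof (intro bexI conjI)
    let ?U = "\<lambda>x y. \<alpha> * V x y + \<beta> * V' x y"
    have V: "V x y > 0" "V' x y > 0" "(\<Sum>y\<in>UNIV. V x y) = 1" "(\<Sum>y\<in>UNIV. V' x y) = 1" for x y
      using that by (auto simp: stoch_def)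
    have "?U x y > 0" for x y
      using V(1,2)[of x y] ab by (cases "\<alpha> = 0") (auto intro: add_pos_nonneg less_imp_le)
    then show "?U \<in> Collect stoch"
      using ab by (simp add: stoch_def sum.distrib sum_distrib_left[symmetric] V)
    have "(\<lambda>x y. \<alpha> * w x y + \<beta> * w x y) = w"
      using ab by (simp add: distrib_right[symmetric])
    then show "cond_kl p ?U w \<le> \<alpha> * cond_kl p V w + \<beta> * cond_kl p V' w"
      using cond_kl_convex[of V w V' w \<alpha> \<beta> p] V wpos ab by simp
    have "output_law p ?U = (\<lambda>y. \<alpha> * output_law p V y + \<beta> * output_law p V' y)"
      by (rule ext) (simp add: output_law_def sum_distrib_left sum.distrib algebra_simps)
    then have "cond_kl p ?U (\<lambda>_. output_law p ?U) \<le>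
        \<alpha> * cond_kl p V (\<lambda>_. output_law p V) + \<beta> * cond_kl p V' (\<lambda>_. output_law p V')"
      using cond_kl_convex[of V "\<lambda>_. output_law p V" V' "\<lambda>_. output_law p V'" \<alpha> \<beta> p] V ab
      by (simp add: output_law_pos)
    moreover have "\<alpha> * ((1 - l) * R) + \<beta> * ((1 - l) * R) = (1 - l) * R"
      using ab by (simp only: distrib_right[symmetric])
    ultimately show "H ?U \<le> \<alpha> * H V + \<beta> * H V'"
      unfolding H_def right_diff_distrib by linarith
  qed
  \<comment> \<open>Slater point: a channel that ignores its input has mutual information 0,
    strictly below the allowed rate.\<close>
  define V0 :: "'x \<Rightarrow> 'y \<Rightarrow> real" where "V0 x = w undefined" for x
  have V0: "V0 \<in> Collect stoch"
    using w(1) by (simp add: stoch_def V0_def)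
  have "output_law p V0 = w undefined"
    by (rule ext) (simp add: output_law_def V0_def sum_distrib_right[symmetric] sum_pmf_UNIV)
  then have "H V0 < 0"
    using R l less_imp_neq[OF wpos] by (simp add: H_def cond_kl_def kl_def V0_def)
  moreover have "c \<le> cond_kl p V w" if "V \<in> Collect stoch" "H V \<le> 0" for V
    using contr that by (auto simp: H_def c_def)
  ultimately obtain \<rho> where \<rho>: "\<rho> \<ge> 0"
    and Lag: "\<And>V. stoch V \<Longrightarrow> c \<le> cond_kl p V w + \<rho> * H V"
    using convex_Lagrange_multiplier[of "Collect stoch" "\<lambda>V. cond_kl p V w" H V0 c] comb V0 by auto
  have "c > 0"
    using E \<eta> l L by (simp add: c_def add_nonneg_pos)
  \<comment> \<open>At \<open>V = w\<close> the objective vanishes while \<open>c > 0\<close>, so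
    the multiplier cannot be 0. This puts \<open>s\<close> strictly inside (0, 1).\<close>
  have "cond_kl p w w = 0"
    using less_imp_neq[OF wpos] by (simp add: cond_kl_def kl_def)
  then have "\<rho> \<noteq> 0"
    using Lag[OF w(1)] \<open>c > 0\<close> by auto
  then have \<rho>: "\<rho> > 0"
    using \<rho> by simp
  define s where "s = \<rho> / (1 + \<rho>)"
  have s: "0 < s" "s < 1" and s\<rho>: "s / (1 - s) = \<rho>"
    using \<rho> by (auto simp: s_def field_simps)
  \<comment> \<open>Solves \<open>k / (1 - s) - \<rho> * R = (c - l * L) / (1 - l)\<close>, the
    value that the hypothesis \<open>dual\<close> will compare with \<open>E\<close>.\<close>
  define k where "k = ((c - l * L) / (1 - l) + \<rho> * R) * (1 - s)"
  have "k / (1 - s) - s / (1 - s) * R \<le> E"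
  proof (rule dual[OF s])
    fix q :: "'y pmf" assume q: "\<And>y. pmf q y > 0"
    let ?J = "\<Sum>x\<in>UNIV. pmf p x * - ln (renyi_sum s (w x) (pmf q))"
    define V where "V = (\<lambda>x y. w x y powr (1 - s) * pmf q y powr s / renyi_sum s (w x) (pmf q))"
    have V: "\<And>y. V x y > 0" "(\<Sum>y\<in>UNIV. V x y) = 1"
      "kl (V x) (w x) + \<rho> * kl (V x) (pmf q) = - ln (renyi_sum s (w x) (pmf q)) / (1 - s)" for x
      using kl_geometric_mixture[where w = "w x" and q = "pmf q", OF s wpos q] by (auto simp: V_def s\<rho>)
    have stV: "stoch V"
      by (simp add: stoch_def V)
    have "c \<le> cond_kl p V w + \<rho> * H V"
      by (rule Lag[OF stV])
    also have "\<rho> * H V \<le> \<rho> * (cond_kl p V (\<lambda>_. pmf q) - (1 - l) * R)"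
      using cond_kl_output_law_le[OF stV q sum_pmf_UNIV] \<rho> by (simp add: H_def)
    also have "cond_kl p V w + \<rho> * (cond_kl p V (\<lambda>_. pmf q) - (1 - l) * R) =
        (\<Sum>x\<in>UNIV. pmf p x * (kl (V x) (w x) + \<rho> * kl (V x) (pmf q))) - \<rho> * ((1 - l) * R)"
      by (simp add: cond_kl_def sum_distrib_left sum.distrib algebra_simps)
    also have "(\<Sum>x\<in>UNIV. pmf p x * (kl (V x) (w x) + \<rho> * kl (V x) (pmf q))) = ?J / (1 - s)"
      by (simp add: V sum_divide_distrib)
    finally have c: "c \<le> ?J / (1 - s) - \<rho> * ((1 - l) * R)"
      by simp
    have "?J \<le> (\<Sum>x\<in>UNIV. pmf p x * ((1 - s) * L))"
      by (intro sum_mono mult_left_mono ln_renyi_sum_bound s w q sum_pmf_UNIV) simp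
    also have "\<dots> = (1 - s) * L"
      by (simp add: sum_distrib_right[symmetric] sum_pmf_UNIV)
    finally have "?J / (1 - s) \<le> L"
      using s by (simp add: divide_le_eq mult.commute)
    \<comment> \<open>The dual value at rate \<open>(1 - l) * R\<close> splits into
      \<open>1 - l\<close> times the value at \<open>R\<close> and \<open>l\<close> times the value
      at rate 0; the latter share is at most \<open>l * L\<close>.\<close>
    then have "l * (?J / (1 - s)) \<le> l * L"
      using l by (intro mult_left_mono) auto
    moreover have "(j - \<rho> * R) * (1 - l) = j - \<rho> * ((1 - l) * R) - l * j" for j
      by algebra
    ultimately have "c - l * L \<le> (?J / (1 - s) - \<rho> * R) * (1 - l)"
      using c by simp
    then have "(c - l * L) / (1 - l) + \<rho> * R \<le> ?J / (1 - s)"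
      using l by (simp add: pos_divide_le_eq[symmetric])
    then show "k \<le> ?J"
      using s by (simp add: k_def pos_le_divide_eq)
  qed
  then have "(c - l * L) / (1 - l) \<le> E"
    using s by (simp add: k_def s\<rho>)
  then have "c - l * L \<le> E * (1 - l)"
    using l by (simp add: pos_divide_le_eq)
  also have "\<dots> \<le> E"
    using E l by (simp add: mult_left_le)
  finally show False
    using \<eta> by (simp add: c_def)
qed

section \<open>Change of measure for codes\<close>

text \<open>Quadratic Taylor bound for the exponential at \<open>- ln t\<close>. It replaces a lower
  bound on the entries of \<open>V\<close>, for which nothing is available.\<close>

lemma mult_ln_squared_le:
  fixes t :: real
  assumes "0 < t" "t \<le> 1"
  shows "t * (ln t)\<^sup>2 \<le> 2"
proof -
  have "1 + (- ln t) + (- ln t)\<^sup>2 / 2 \<le> exp (- ln t)"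
    using assms by (intro exp_lower_Taylor_quadratic) simp
  also have "exp (- ln t) = 1 / t"
    using assms by (simp add: exp_minus inverse_eq_divide)
  finally have "1 - ln t + (ln t)\<^sup>2 / 2 \<le> 1 / t"
    by simp
  moreover have "ln t \<le> 0"
    using assms by simp
  ultimately have "(ln t)\<^sup>2 / 2 \<le> 1 / t"
    by linarith
  then show ?thesis
    using assms by (simp add: field_simps)
qed

lemma square_ln_divide_le:
  fixes u v :: real
  assumes "u > 0" "v > 0"
  shows "(ln (u / v))\<^sup>2 \<le> 2 * (ln u)\<^sup>2 + 2 * (ln v)\<^sup>2"
proof -
  have "(ln (u / v))\<^sup>2 + (ln u + ln v)\<^sup>2 = 2 * (ln u)\<^sup>2 + 2 * (ln v)\<^sup>2"
    using assms by (simp add: ln_div power2_eq_square algebra_simps)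
  then show ?thesis
    using zero_le_power2[of "ln u + ln v"] by linarith
qed

lemma stoch_le_one: "stoch V \<Longrightarrow> V x y \<le> 1"
  using member_le_sum[of y UNIV "V x"] by (auto simp: stoch_def less_imp_le)

text \<open>Holds for each input letter, as \<open>w\<close> is bounded below. The argument yields 4
  per output letter; 8 matches \<open>second_moment_output_law\<close>, so that one \<sigma> serves
  both ratios.\<close>

lemma second_moment_lower_bounded:
  fixes V w :: "'x \<Rightarrow> 'y::finite \<Rightarrow> real"
  assumes "stoch V" "stoch w" and w: "\<And>x y. w x y \<ge> exp (- L)"
  shows "(\<Sum>y\<in>UNIV. V x y * (ln (V x y / w x y))\<^sup>2) \<le> 8 * real CARD('y) + 2 * L\<^sup>2"
proof -
  have V: "V x y > 0" "V x y \<le> 1" "(\<Sum>y\<in>UNIV. V x y) = 1" for y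
    using assms(1) by (auto simp: stoch_def stoch_le_one)
  have wx: "w x y > 0" "w x y \<le> 1" for y
    using assms(2) by (auto simp: stoch_def stoch_le_one)
  have "V x y * (ln (V x y / w x y))\<^sup>2 \<le> 4 + V x y * (2 * L\<^sup>2)" for y
  proof -
    have "- L \<le> ln (w x y)"
      using w[of x y] wx by (metis ln_exp ln_le_cancel_iff exp_gt_zero)
    moreover have "ln (w x y) \<le> 0"
      using wx by simp
    ultimately have "(ln (w x y))\<^sup>2 \<le> L\<^sup>2"
      by (intro power2_le_iff_abs_le[THEN iffD2]) auto
    then have "(ln (V x y / w x y))\<^sup>2 \<le> 2 * (ln (V x y))\<^sup>2 + 2 * L\<^sup>2"
      using square_ln_divide_le[of "V x y" "w x y"] V wx by force
    then have "V x y * (ln (V x y / w x y))\<^sup>2 \<le> V x y * (2 * (ln (V x y))\<^sup>2 + 2 * L\<^sup>2)"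
      using V by (intro mult_left_mono) (auto simp: less_imp_le)
    then show ?thesis
      using mult_ln_squared_le[of "V x y"] V by (simp add: distrib_left)
  qed
  then have "(\<Sum>y\<in>UNIV. V x y * (ln (V x y / w x y))\<^sup>2) \<le> (\<Sum>y\<in>UNIV. 4 + V x y * (2 * L\<^sup>2))"
    by (intro sum_mono)
  also have "\<dots> = 4 * real CARD('y) + 2 * L\<^sup>2"
    by (simp add: sum.distrib sum_distrib_right[symmetric] V)
  finally show ?thesis by simp
qed

text \<open>A single letter \<open>x\<close> of small weight admits no uniform bound, because the
  output law may be tiny where \<open>V x\<close> is not. Averaging over \<open>p\<close> turns the
  weight of \<open>(ln (output_law p V y))\<^sup>2\<close> into the output law itself, and
  \<open>mult_ln_squared_le\<close> applies again.\<close>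

lemma second_moment_output_law:
  fixes p :: "'x::finite pmf" and V :: "'x \<Rightarrow> 'y::finite \<Rightarrow> real"
  assumes "stoch V"
  shows "(\<Sum>x\<in>UNIV. pmf p x * (\<Sum>y\<in>UNIV. V x y * (ln (V x y / output_law p V y))\<^sup>2)) \<le> 8 * real CARD('y)"
proof -
  let ?r = "output_law p V"
  have V: "V x y > 0" "V x y \<le> 1" for x y
    using assms by (auto simp: stoch_def stoch_le_one)
  have r: "?r y > 0" for y
    using V by (intro output_law_pos)
  have r1: "?r y \<le> 1" for y
    using member_le_sum[of y UNIV ?r] r sum_output_law[OF assms, of p] by (auto simp: less_imp_le)
  have *: "V x y * (ln (V x y / ?r y))\<^sup>2 \<le> 4 + V x y * (2 * (ln (?r y))\<^sup>2)" for x y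
  proof -
    have "V x y * (ln (V x y / ?r y))\<^sup>2 \<le> V x y * (2 * (ln (V x y))\<^sup>2 + 2 * (ln (?r y))\<^sup>2)"
      using V r by (intro mult_left_mono square_ln_divide_le) (auto simp: less_imp_le)
    then show ?thesis
      using mult_ln_squared_le[of "V x y"] V[of x y] by (simp add: distrib_left)
  qed
  have "(\<Sum>x\<in>UNIV. pmf p x * (\<Sum>y\<in>UNIV. V x y * (ln (V x y / ?r y))\<^sup>2)) \<le>
      (\<Sum>x\<in>UNIV. pmf p x * (\<Sum>y\<in>UNIV. 4 + V x y * (2 * (ln (?r y))\<^sup>2)))"
    by (intro sum_mono mult_left_mono *) simp
  also have "\<dots> = (\<Sum>x\<in>UNIV. pmf p x) * (4 * real CARD('y)) +
      (\<Sum>x\<in>UNIV. \<Sum>y\<in>UNIV. pmf p x * V x y * (2 * (ln (?r y))\<^sup>2))"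
    by (simp add: sum.distrib distrib_left sum_distrib_left sum_distrib_right mult_ac)
  also have "(\<Sum>x\<in>UNIV. \<Sum>y\<in>UNIV. pmf p x * V x y * (2 * (ln (?r y))\<^sup>2)) = (\<Sum>y\<in>UNIV. ?r y * (2 * (ln (?r y))\<^sup>2))"
    by (subst sum.swap) (simp add: output_law_def sum_distrib_right)
  also have "\<dots> \<le> (\<Sum>y\<in>(UNIV :: 'y set). 4)"
    using mult_ln_squared_le[OF r r1] by (intro sum_mono) (auto simp: mult.left_commute)
  finally show ?thesis
    by (simp add: sum_pmf_UNIV)
qed

section \<open>Types and a pigeonhole over messages\<close>

text \<open>The empirical law of the letters of a word, meaningful only for nonempty words.\<close>

definition type_of :: "'x list \<Rightarrow> 'x pmf" where
  "type_of xs = pmf_of_multiset (mset xs)"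

text \<open>Both sides count letters with multiplicity. This turns sums along a codeword into the
  \<open>p\<close>-averages in \<open>cond_kl\<close>, with \<open>p\<close> the type.\<close>

lemma sum_nth_eq_mean_type:
  fixes \<phi> :: "'x::finite \<Rightarrow> real"
  assumes "length xs = n" "n > 0"
  shows "(\<Sum>i<n. \<phi> (xs ! i)) = real n * (\<Sum>x\<in>UNIV. pmf (type_of xs) x * \<phi> x)"
proof -
  have count: "sum_list (map \<phi> xs) = (\<Sum>x\<in>UNIV. real (count (mset xs) x) * \<phi> x)" for xs
  proof (induction xs)
    case (Cons a xs)
    have "(\<Sum>x\<in>UNIV. real (count (mset (a # xs)) x) * \<phi> x) =
        (\<Sum>x\<in>UNIV. (if a = x then \<phi> x else 0) + real (count (mset xs) x) * \<phi> x)"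
      by (intro sum.cong) (auto simp: distrib_right)
    then show ?case
      using Cons by (simp add: sum.distrib)
  qed simp
  have "mset xs \<noteq> {#}"
    using assms by auto
  then have "real n * (\<Sum>x\<in>UNIV. pmf (type_of xs) x * \<phi> x) = (\<Sum>x\<in>UNIV. real (count (mset xs) x) * \<phi> x)"
    using assms by (simp add: type_of_def sum_distrib_left)
  moreover have "(\<Sum>i<n. \<phi> (xs ! i)) = sum_list (map \<phi> xs)"
    using assms by (simp add: sum_list_sum_nth atLeast0LessThan)
  ultimately show ?thesis
    using count by simp
qed

text \<open>A type is determined by the letter counts, each of which lies in
  \<open>{..n}\<close>.\<close>

lemma card_types_le:
  fixes enc :: "nat \<Rightarrow> 'x::finite list"
  assumes "\<And>m. m < M \<Longrightarrow> length (enc m) = n"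
  shows "card ((\<lambda>m. type_of (enc m)) ` {..<M}) \<le> (n + 1) ^ CARD('x)"
proof -
  let ?S = "(\<lambda>m. mset (enc m)) ` {..<M}"
  have "(\<lambda>m. type_of (enc m)) ` {..<M} = pmf_of_multiset ` ?S"
    by (auto simp: type_of_def)
  then have "card ((\<lambda>m. type_of (enc m)) ` {..<M}) \<le> card ?S"
    by (simp add: card_image_le)
  also have "card ?S = card (count ` ?S)"
    by (rule card_image[symmetric]) (auto simp: inj_on_def count_inject)
  also have "\<dots> \<le> card (PiE (UNIV :: 'x set) (\<lambda>_. {..n}))"
  proof (rule card_mono)
    have "count (mset (enc m)) x \<le> n" if "m < M" for m x
      using count_le_size[of "mset (enc m)" x] assms[OF that] by simp
    then show "count ` ?S \<subseteq> PiE UNIV (\<lambda>_. {..n})"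
      by auto
  qed (auto intro: finite_PiE)
  finally show ?thesis
    by (simp add: card_PiE)
qed

text \<open>For a fixed law the decoding regions are disjoint and their masses add up to at most 1.
  Summing over at most \<open>T\<close> laws and averaging over \<open>M\<close> messages gives the
  bound, although the law may depend on the message through \<open>ty\<close>.\<close>

lemma exists_message_low_probability:
  fixes Q :: "'c \<Rightarrow> 'a::finite list \<Rightarrow> real"
  assumes Q: "\<And>c ys. Q c ys \<ge> 0" "\<And>c. (\<Sum>ys\<in>words n. Q c ys) = 1"
    and M: "M > 0" and T: "card (ty ` {..<M}) \<le> T"
  shows "\<exists>m<M. (\<Sum>ys | length ys = n \<and> dec ys = m. Q (ty m) ys) \<le> real T / real M"
proof (rule ccontr)
  assume contr: "\<not> ?thesis"
  define A where "A c m = (\<Sum>ys | length ys = n \<and> dec ys = m. Q c ys)" for c m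
  have A: "A c m = (\<Sum>ys\<in>words n. if dec ys = m then Q c ys else 0)" for c m
    unfolding A_def by (rule sum.mono_neutral_cong_left) auto
  have tot: "(\<Sum>m<M. A c m) \<le> 1" for c
  proof -
    have "(\<Sum>m<M. A c m) = (\<Sum>ys\<in>words n. \<Sum>m<M. if dec ys = m then Q c ys else 0)"
      unfolding A by (rule sum.swap)
    also have "\<dots> \<le> (\<Sum>ys\<in>words n. Q c ys)"
      by (rule sum_mono) (simp add: sum.delta' Q)
    finally show ?thesis by (simp add: Q)
  qed
  have "real T = (\<Sum>m<M. real T / real M)"
    using M by simp
  also have "\<dots> < (\<Sum>m<M. A (ty m) m)"
    using contr M by (intro sum_strict_mono) (auto simp: A_def not_le)
  \<comment> \<open>Charging every message under all laws, not only its own, decouples law and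
    message so that the sums can be exchanged.\<close>
  also have "\<dots> \<le> (\<Sum>m<M. \<Sum>c\<in>ty ` {..<M}. A c m)"
    by (intro sum_mono member_le_sum) (auto simp: A_def sum_nonneg Q)
  also have "\<dots> = (\<Sum>c\<in>ty ` {..<M}. \<Sum>m<M. A c m)"
    by (rule sum.swap)
  also have "\<dots> \<le> (\<Sum>c\<in>ty ` {..<M}. 1)"
    by (intro sum_mono tot)
  also have "\<dots> \<le> real T"
    using T by simp
  finally show False by simp
qed

text \<open>A channel is fixed for every type in advance, and only then the pigeonhole selects a
  message; hence \<open>dual\<close> is assumed for all \<open>p\<close>. Condition
  \<open>rate\<close> makes the slack \<open>n * l * R\<close> pay for the deviation
  \<open>t\<close>, the number of types and the factor 4 required by
  \<open>change_of_measure\<close>.\<close>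

lemma code_error_lower_bound:
  fixes W :: "'x::finite \<Rightarrow> 'y::finite pmf"
  assumes W: "\<And>x y. pmf (W x) y \<ge> exp (- L)"
    and R: "R > 0" and l: "0 \<le> l" "l < 1" and E: "E \<ge> 0" and \<eta>: "\<eta> > 0"
    and dual: "\<And>(p :: 'x pmf) s k. 0 < s \<Longrightarrow> s < 1 \<Longrightarrow>
      (\<And>q :: 'y pmf. (\<And>y. pmf q y > 0) \<Longrightarrow> k \<le> (\<Sum>x\<in>UNIV. pmf p x * - ln (renyi_sum s (pmf (W x)) (pmf q)))) \<Longrightarrow>
      k / (1 - s) - s / (1 - s) * R \<le> E"
    and code: "is_code n R M enc" and n: "n > 0"
    and t: "t > 0" "4 * (real n * (8 * real CARD('y) + 2 * L\<^sup>2)) \<le> t\<^sup>2"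
    and rate: "real n * l * R \<ge> t + real CARD('x) * ln (real n + 1) + ln 4"
  shows "exp (- (real n * (E + l * L + \<eta>) + t)) / 4 \<le> Pe_max W n M enc dec"
proof -
  define w where "w = (\<lambda>x. pmf (W x))"
  have w: "stoch w" "\<And>x y. w x y \<ge> exp (- L)"
    using W by (auto simp: stoch_def w_def sum_pmf_UNIV intro: less_le_trans[OF exp_gt_zero])
  have "\<exists>V. stoch V \<and> cond_kl p V (\<lambda>_. output_law p V) \<le> (1 - l) * R \<and> cond_kl p V w \<le> E + l * L + \<eta>"
    for p :: "'x pmf"
    using dual[of _ _ p] by (intro exists_auxiliary_channel w R l E \<eta>) (auto simp: w_def)
  then obtain V where V: "\<And>p :: 'x pmf. stoch (V p)"
      "\<And>p. cond_kl p (V p) (\<lambda>_. output_law p (V p)) \<le> (1 - l) * R"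
      "\<And>p. cond_kl p (V p) w \<le> E + l * L + \<eta>"
    by metis
  define r where "r p = output_law p (V p)" for p
  have Vpos: "V p x y > 0" for p x y
    using V(1)[of p] by (simp add: stoch_def)
  have rpos: "r p y > 0" for p y
    unfolding r_def using Vpos by (intro output_law_pos)
  have len: "length (enc m) = n" if "m < M" for m
    using code that by (simp add: is_code_def)
  have M: "real M \<ge> exp (real n * R)"
    using code by (simp add: is_code_def)
  then have M0: "M > 0"
    using exp_gt_zero[of "real n * R"] by (cases M) auto
  let ?Q = "\<lambda>p ys. \<Prod>i<n. r p (ys ! i)"
  let ?T = "(n + 1) ^ CARD('x)"
  have "\<exists>m<M. (\<Sum>ys | length ys = n \<and> dec ys = m. ?Q (type_of (enc m)) ys) \<le> real ?T / real M"
  proof (rule exists_message_low_probability[OF _ _ M0 card_types_le])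
    show "(\<Sum>ys\<in>words n. ?Q p ys) = 1" for p
      using sum_words_prod[of "\<lambda>_. r p" n] sum_output_law[OF V(1)] by (simp add: r_def)
  qed (use len rpos in \<open>auto intro: prod_nonneg simp: less_imp_le\<close>)
  then obtain m where m: "m < M"
    and Qm: "(\<Sum>ys | length ys = n \<and> dec ys = m. ?Q (type_of (enc m)) ys) \<le> real ?T / real M"
    by blast
  define p where "p = type_of (enc m)"
  note mean = sum_nth_eq_mean_type[OF len[OF m] n, folded p_def]
  let ?\<sigma> = "real n * (8 * real CARD('y) + 2 * L\<^sup>2)"
  have "exp (- (real n * (E + l * L + \<eta>) + t)) / 4 \<le>
      (\<Sum>ys | length ys = n \<and> dec ys \<noteq> m. \<Prod>i<n. w (enc m ! i) (ys ! i))"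
  proof (rule change_of_measure[where v = "\<lambda>i. V p (enc m ! i)" and q = "\<lambda>_. r p" and \<sigma> = ?\<sigma>
        and H = "real n * ((1 - l) * R)" and w = "\<lambda>i. w (enc m ! i)"])
    show "(\<Sum>y\<in>UNIV. V p (enc m ! i) y) = 1" for i
      using V(1)[of p] by (simp add: stoch_def)
    show "w (enc m ! i) y > 0" for i y
      using w by (simp add: stoch_def)
    show "(\<Sum>i<n. \<Sum>y\<in>UNIV. V p (enc m ! i) y * (ln (V p (enc m ! i) y / w (enc m ! i) y))\<^sup>2) \<le> ?\<sigma>"
      using sum_bounded_above[of "{..<n}", OF second_moment_lower_bounded[OF V(1) w]] by simp
    have "(\<Sum>i<n. \<Sum>y\<in>UNIV. V p (enc m ! i) y * (ln (V p (enc m ! i) y / r p y))\<^sup>2) =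
        real n * (\<Sum>x\<in>UNIV. pmf p x * (\<Sum>y\<in>UNIV. V p x y * (ln (V p x y / r p y))\<^sup>2))"
      by (rule mean)
    also have "\<dots> \<le> real n * (8 * real CARD('y))"
      unfolding r_def by (intro mult_left_mono second_moment_output_law V) simp
    also have "\<dots> \<le> ?\<sigma>"
      by (simp add: mult_left_mono)
    finally show "(\<Sum>i<n. \<Sum>y\<in>UNIV. V p (enc m ! i) y * (ln (V p (enc m ! i) y / r p y))\<^sup>2) \<le> ?\<sigma>" .
    show "(\<Sum>i<n. \<Sum>y\<in>UNIV. V p (enc m ! i) y * ln (V p (enc m ! i) y / w (enc m ! i) y)) \<le>
        real n * (E + l * L + \<eta>)"
      using V(3)[of p] mean[of "\<lambda>x. kl (V p x) (w x)"] n by (simp add: kl_def cond_kl_def mult_left_mono)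
    show "(\<Sum>i<n. \<Sum>y\<in>UNIV. V p (enc m ! i) y * ln (V p (enc m ! i) y / r p y)) \<le> real n * ((1 - l) * R)"
      using V(2)[of p] mean[of "\<lambda>x. kl (V p x) (r p)"] n by (simp add: kl_def cond_kl_def r_def mult_left_mono)
    have "exp (real n * ((1 - l) * R) + t) * (\<Sum>ys | length ys = n \<and> dec ys = m. \<Prod>i<n. r p (ys ! i)) \<le>
        exp (real n * ((1 - l) * R) + t) * (real ?T / exp (real n * R))"
    proof (rule mult_left_mono)
      have "real ?T / real M \<le> real ?T / exp (real n * R)"
        using M by (intro divide_left_mono) (auto simp: M0)
      then show "(\<Sum>ys | length ys = n \<and> dec ys = m. \<Prod>i<n. r p (ys ! i)) \<le> real ?T / exp (real n * R)"
        using Qm by (simp add: p_def)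
    qed simp
    also have "real ?T = exp (real CARD('x) * ln (real n + 1))"
      by (simp add: exp_of_nat_mult add.commute)
    also have "exp (real n * ((1 - l) * R) + t) * (exp (real CARD('x) * ln (real n + 1)) / exp (real n * R)) =
        exp (t + real CARD('x) * ln (real n + 1) - real n * l * R)"
      by (simp add: exp_add[symmetric] exp_diff[symmetric] algebra_simps)
    also have "\<dots> \<le> exp (- ln 4)"
      using rate by simp
    also have "\<dots> = 1 / 4"
      by (simp add: exp_minus)
    finally show "exp (real n * ((1 - l) * R) + t) *
        (\<Sum>ys | length ys = n \<and> dec ys = m. \<Prod>i<n. r p (ys ! i)) \<le> 1 / 4" .
  qed (use Vpos rpos t in auto)
  also have "\<dots> = msg_err W n enc dec m"
    by (simp add: msg_err_def w_def)
  also have "\<dots> \<le> Pe_max W n M enc dec"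
    unfolding Pe_max_def using m by (intro Max_ge) auto
  finally show ?thesis .
qed

section \<open>Comparison of \<open>E_fsp\<close> with the classical exponent\<close>

text \<open>Multiplying \<open>ftilde\<close> at \<open>P / q\<close> by \<open>q\<close> gives
  \<open>P - P * f (q / P)\<close>, so the divergence is 1 minus the mean of \<open>f\<close> of the
  likelihood ratio, and \<open>Gfun\<close> takes minus the logarithm of that mean.\<close>

lemma Dh_ftilde:
  assumes "\<And>y. pmf P y > 0" "\<And>y. pmf q y > 0"
  shows "Gfun (Dh (ftilde \<psi> s) P q) = - ln (\<Sum>y\<in>UNIV. pmf P y * fs \<psi> s (pmf q y / pmf P y))"
proof -
  have "Dh (ftilde \<psi> s) P q = (\<Sum>y\<in>UNIV. pmf P y - pmf P y * fs \<psi> s (pmf q y / pmf P y))"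
    unfolding Dh_def ftilde_def
    using assms by (intro sum.cong) (auto simp: less_imp_neq[symmetric] right_diff_distrib)
  then show ?thesis
    by (simp add: Gfun_def sum_subtractf sum_pmf_UNIV)
qed

text \<open>Some letter has positive weight and \<open>W\<close> is positive, so absolute continuity
  forces \<open>q\<close> to be positive everywhere. The uniform law shows that the infimum is over
  a nonempty set.\<close>

lemma I_G_h_ge:
  fixes W :: "'x::finite \<Rightarrow> 'y::finite pmf"
  assumes W: "\<And>x y. pmf (W x) y > 0"
    and k: "\<And>q. (\<And>y. pmf q y > 0) \<Longrightarrow> k \<le> (\<Sum>x\<in>UNIV. pmf p x * G (Dh h (W x) q))"
  shows "k \<le> I_G_h G h p W"
  unfolding I_G_h_def
proof (rule cINF_greatest)
  let ?S = "{q :: 'y pmf. \<forall>x y. pmf p x > 0 \<longrightarrow> pmf (W x) y > 0 \<longrightarrow> pmf q y > 0}"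
  have "pmf_of_set UNIV \<in> ?S"
    by simp
  then show "?S \<noteq> {}"
    by blast
  fix q assume q: "q \<in> ?S"
  obtain x where "pmf p x > 0"
    using set_pmf_not_empty[of p] by (auto simp: pmf_positive_iff)
  then have "pmf q y > 0" for y
    using q W by auto
  then show "k \<le> (\<Sum>x\<in>UNIV. pmf p x * G (Dh h (W x) q))"
    by (rule k)
qed

text \<open>Applies \<open>mean_le_mean_powr\<close> to the ratio \<open>q / P\<close> under
  \<open>P\<close>. The positivity claim, from \<open>\<psi> \<ge> a > 0\<close>, is what makes the
  logarithms of the two sums comparable.\<close>

lemma renyi_sum_ge_fs_sum:
  fixes \<psi> :: "real \<Rightarrow> real \<Rightarrow> real" and P q :: "'y::finite pmf"
  assumes ab: "0 < a" "\<And>t. a \<le> \<psi> s t" "\<And>t. \<psi> s t \<le> b" and psi_0: "\<psi> s 0 = 1"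
    and f_diff: "\<And>x. x > 0 \<Longrightarrow> fs \<psi> s differentiable (at x) \<and> deriv (fs \<psi> s) differentiable (at x)"
    and g_diff: "\<And>x. x > 0 \<Longrightarrow> gs \<psi> s differentiable (at x) \<and> deriv (gs \<psi> s) differentiable (at x)"
    and g_ineq: "\<And>x \<alpha>. x \<ge> 0 \<Longrightarrow> \<alpha> > 0 \<Longrightarrow>
      x\<^sup>2 * deriv (deriv (gs \<psi> s)) x + gs \<psi> s \<alpha> * gs \<psi> s (x / \<alpha>) \<le> 0"
    and P: "\<And>y. pmf P y > 0" and q: "\<And>y. pmf q y > 0"
  shows "0 < (\<Sum>y\<in>UNIV. pmf P y * fs \<psi> s (pmf q y / pmf P y))"
    and "(\<Sum>y\<in>UNIV. pmf P y * fs \<psi> s (pmf q y / pmf P y)) \<le> renyi_sum s (pmf P) (pmf q)"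
proof -
  have fpos: "fs \<psi> s x > 0" if "x > 0" for x
    using that ab(1) ab(2)[of "ln x"] by (simp add: fs_def)
  show "0 < (\<Sum>y\<in>UNIV. pmf P y * fs \<psi> s (pmf q y / pmf P y))"
    using P q by (intro sum_pos mult_pos_pos fpos) auto
  have "(\<Sum>y\<in>UNIV. pmf P y * fs \<psi> s (pmf q y / pmf P y)) \<le>
      (\<Sum>y\<in>UNIV. pmf P y * (pmf q y / pmf P y) powr s)"
  proof (rule mean_le_mean_powr[where f' = "deriv (fs \<psi> s)" and f'' = "deriv (deriv (fs \<psi> s))"
        and g = "gs \<psi> s" and g' = "deriv (gs \<psi> s)" and g'' = "deriv (deriv (gs \<psi> s))" and b = b])
    show "fs \<psi> s 1 = 1"
      by (simp add: fs_def psi_0)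
    show "gs \<psi> s x = - (x\<^sup>2) * deriv (deriv (fs \<psi> s)) x" for x
      by (simp add: gs_def)
    show "fs \<psi> s x \<le> b * x powr s" if "x > 0" for x
      using that ab(3)[of "ln x"] by (simp add: fs_def mult.commute mult_left_mono)
    show "(\<Sum>y\<in>UNIV. pmf P y * (pmf q y / pmf P y)) = 1"
      using P by (simp add: less_imp_neq[symmetric] sum_pmf_UNIV)
  qed (use f_diff g_diff g_ineq fpos P q in
      \<open>auto simp: DERIV_deriv_iff_real_differentiable sum_pmf_UNIV less_imp_le\<close>)
  also have "\<dots> = renyi_sum s (pmf P) (pmf q)"
    unfolding renyi_sum_def
  proof (intro sum.cong refl)
    fix y
    show "pmf P y * (pmf q y / pmf P y) powr s = pmf P y powr (1 - s) * pmf q y powr s"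
      using P[of y] q[of y] by (simp add: powr_divide powr_diff)
  qed
  finally show "(\<Sum>y\<in>UNIV. pmf P y * fs \<psi> s (pmf q y / pmf P y)) \<le> renyi_sum s (pmf P) (pmf q)" .
qed

text \<open>Young's inequality termwise. It makes 0 an admissible lower bound for the dual
  objective.\<close>

lemma renyi_sum_le_one:
  assumes s: "0 < s" "s < 1" and u: "\<And>y. u y > 0" "(\<Sum>y\<in>UNIV. u y) = 1"
    and q: "\<And>y. q y > 0" "(\<Sum>y\<in>UNIV. q y) = 1"
  shows "renyi_sum s u q \<le> 1"
proof -
  have "u y powr (1 - s) * q y powr s \<le> (1 - s) * u y + s * q y" for y
    using Youngs_inequality_0[of "1 - s" s "u y" "q y"] s u(1)[of y] q(1)[of y] by simp
  then have "renyi_sum s u q \<le> (\<Sum>y\<in>UNIV. (1 - s) * u y + s * q y)"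
    unfolding renyi_sum_def by (intro sum_mono)
  also have "\<dots> = 1"
    using u q by (simp add: sum.distrib sum_distrib_left[symmetric])
  finally show ?thesis .
qed

theorem theorem9:
  fixes \<psi> :: "real \<Rightarrow> real \<Rightarrow> real" and a b :: real
    and W :: "'x::finite \<Rightarrow> 'y::finite pmf"
  assumes ab: "0 < a" "a < b"
    and psi_range: "\<forall>s\<in>{0<..<1}. \<forall>t. a \<le> \<psi> s t \<and> \<psi> s t \<le> b"
    and psi_0: "\<forall>s\<in>{0<..<1}. \<psi> s 0 = 1"
    and f_diff: "\<forall>s\<in>{0<..<1}. \<forall>x>0. fs \<psi> s differentiable (at x) \<and>
                    deriv (fs \<psi> s) differentiable (at x)"
    and g_diff: "\<forall>s\<in>{0<..<1}. \<forall>x>0. gs \<psi> s differentiable (at x) \<and>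
                    deriv (gs \<psi> s) differentiable (at x)"
    and g_nonneg: "\<forall>s\<in>{0<..<1}. \<forall>x\<ge>0. gs \<psi> s x \<ge> 0"
    and g_ineq: "\<forall>s\<in>{0<..<1}. \<forall>x\<ge>0. \<forall>\<alpha>>0.
                    x ^ 2 * deriv (deriv (gs \<psi> s)) x + gs \<psi> s \<alpha> * gs \<psi> s (x / \<alpha>) \<le> 0"
    and Wmin: "\<forall>x y. pmf (W x) y > 0"
  shows "\<forall>R>0.
      (\<exists>K N (\<delta> :: nat \<Rightarrow> real) (\<epsilon> :: nat \<Rightarrow> real). \<forall>n\<ge>N.
          \<bar>\<delta> n\<bar> \<le> K / real n \<and> \<bar>\<epsilon> n\<bar> \<le> K / sqrt (real n) \<and>
          (\<forall>M enc dec. is_code n R M enc \<longrightarrow>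
              E_fsp \<psi> W (R - \<delta> n) = \<infinity> \<or>
              Pe_max W n M enc dec >
                exp (- (real n * (real_of_ereal (E_fsp \<psi> W (R - \<delta> n)) + \<epsilon> n)))))
      \<and> error_exponent W R \<le> E_fsp \<psi> W R"
proof (intro allI impI)
  fix R :: real assume R: "R > 0"
  let ?claim1 = "\<lambda>K N \<delta> \<epsilon>. \<forall>n\<ge>N.
          \<bar>\<delta> n\<bar> \<le> K / real n \<and> \<bar>\<epsilon> n\<bar> \<le> K / sqrt (real n) \<and>
          (\<forall>M enc dec. is_code n R M enc \<longrightarrow>
              E_fsp \<psi> W (R - \<delta> n) = \<infinity> \<or>
              Pe_max W n M enc dec >
                exp (- (real n * (real_of_ereal (E_fsp \<psi> W (R - \<delta> n)) + \<epsilon> n))))"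
  let ?goal = "(\<exists>K N (\<delta> :: nat \<Rightarrow> real) (\<epsilon> :: nat \<Rightarrow> real). ?claim1 K N \<delta> \<epsilon>) \<and> error_exponent W R \<le> E_fsp \<psi> W R"
  have W: "pmf (W x) y > 0" for x y
    using Wmin by simp
  \<comment> \<open>Domination of the classical exponent, in the form demanded by the hypothesis
    \<open>dual\<close> of \<open>code_error_lower_bound\<close>.\<close>
  have E_ge: "ereal (k / (1 - s) - s / (1 - s) * R) \<le> E_fsp \<psi> W R"
    if s: "0 < s" "s < 1"
      and k: "\<And>q :: 'y pmf. (\<And>y. pmf q y > 0) \<Longrightarrow>
        k \<le> (\<Sum>x\<in>UNIV. pmf p x * - ln (renyi_sum s (pmf (W x)) (pmf q)))"
    for p :: "'x pmf" and s k
  proof -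
    have "k \<le> I_G_h Gfun (ftilde \<psi> s) p W"
    proof (rule I_G_h_ge[OF W])
      fix q :: "'y pmf" assume q: "\<And>y. pmf q y > 0"
      have "- ln (renyi_sum s (pmf (W x)) (pmf q)) \<le> Gfun (Dh (ftilde \<psi> s) (W x) q)" for x
        unfolding Dh_ftilde[OF W q]
        using renyi_sum_ge_fs_sum[of a \<psi> s b "W x" q] ab psi_range psi_0 f_diff g_diff g_ineq s W q
        by auto
      then have "(\<Sum>x\<in>UNIV. pmf p x * - ln (renyi_sum s (pmf (W x)) (pmf q))) \<le>
          (\<Sum>x\<in>UNIV. pmf p x * Gfun (Dh (ftilde \<psi> s) (W x) q))"
        by (intro sum_mono mult_left_mono) auto
      with k[OF q] show "k \<le> (\<Sum>x\<in>UNIV. pmf p x * Gfun (Dh (ftilde \<psi> s) (W x) q))"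
        by linarith
    qed
    then have "ereal (k / (1 - s) - s / (1 - s) * R) \<le>
        ereal (I_G_h Gfun (ftilde \<psi> s) p W / (1 - s) - s / (1 - s) * R)"
      using s by (simp add: divide_right_mono)
    also have "\<dots> \<le> E_fsp \<psi> W R"
      unfolding E_fsp_def using s by (intro SUP_upper2[of p] SUP_upper) auto
    finally show ?thesis .
  qed
  \<comment> \<open>Taking \<open>k = 0\<close> and any input law excludes the value minus infinity;
    small \<rho> then gives nonnegativity.\<close>
  have E_ge0: "ereal (- (\<rho> * R)) \<le> E_fsp \<psi> W R" if \<rho>: "\<rho> > 0" for \<rho>
  proof -
    define s where "s = \<rho> / (1 + \<rho>)"
    have s: "0 < s" "s < 1" and s\<rho>: "s / (1 - s) = \<rho>"
      using \<rho> by (auto simp: s_def field_simps)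
    have "0 \<le> (\<Sum>x\<in>UNIV. pmf (pmf_of_set UNIV) x * - ln (renyi_sum s (pmf (W x)) (pmf q)))"
      if q: "\<And>y. pmf q y > 0" for q :: "'y pmf"
    proof -
      have "ln (renyi_sum s (pmf (W x)) (pmf q)) \<le> 0" for x
        using renyi_sum_le_one[OF s W sum_pmf_UNIV q sum_pmf_UNIV, of x] renyi_sum_pos[of "pmf (W x)" "pmf q" s] W q
        by simp
      then show ?thesis
        by (intro sum_nonneg mult_nonneg_nonneg) auto
    qed
    from E_ge[OF s this] show ?thesis
      by (simp add: s\<rho>)
  qed
  show ?goal
  proof (cases "E_fsp \<psi> W R = \<infinity>")
    case True
    then have "?claim1 0 0 (\<lambda>_. 0) (\<lambda>_. 0)"
      by simp
    with True show ?thesis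
      by (auto intro!: exI[of _ "0 :: real"] exI[of _ "0 :: nat"] exI[of _ "\<lambda>_. 0 :: real"])
  next
    case False
    then obtain E where E: "E_fsp \<psi> W R = ereal E"
      using E_ge0[of 1] by (cases "E_fsp \<psi> W R") auto
    have E0: "E \<ge> 0"
    proof (rule ccontr)
      assume "\<not> E \<ge> 0"
      then show False
        \<comment> \<open>With this \<rho> the bound reads \<open>E / 2 \<le> E\<close>, impossible
          for negative \<open>E\<close>.\<close>
        using E_ge0[of "- E / (2 * R)"] R E by (simp add: divide_neg_pos)
    qed
    define L where "L = Max (range (\<lambda>(x, y). - ln (pmf (W x) y)))"
    have L: "pmf (W x) y \<ge> exp (- L)" for x y
    proof -
      have "- ln (pmf (W x) y) \<le> L"
        unfolding L_def by (rule Max_ge) (auto intro: image_eqI[of _ _ "(x, y)"])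
      then have "exp (- L) \<le> exp (ln (pmf (W x) y))"
        by simp
      then show ?thesis
        using W[of x y] by simp
    qed
    \<comment> \<open>Here \<open>v\<close> bounds the second moment per letter,
      \<open>t = c1 * sqrt n\<close> satisfies \<open>4 * n * v = t\<^sup>2\<close>, and
      \<open>l = c2 / sqrt n\<close>. The summands of \<open>c2\<close> pay for \<open>t\<close>,
      for the types via \<open>ln (n + 1) \<le> 2 * sqrt n\<close>, and for \<open>ln 4 < 2\<close>.
      The 3 in \<open>K\<close> covers \<open>\<eta> = 1 / sqrt n\<close> and \<open>ln 4\<close>;
      \<open>N\<close> ensures \<open>l < 1\<close> and \<open>n > 0\<close>.\<close>
    define v where "v = 8 * real CARD('y) + 2 * L\<^sup>2"
    define c1 where "c1 = 2 * sqrt v"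
    define c2 where "c2 = (c1 + 2 * real CARD('x) + 2) / R"
    define K where "K = c2 * \<bar>L\<bar> + c1 + 3"
    define N where "N = nat \<lceil>c2\<^sup>2\<rceil> + 1"
    have v: "v > 0"
      by (simp add: v_def add_pos_nonneg)
    have c1: "c1 > 0"
      using v by (simp add: c1_def)
    have c2: "c2 > 0"
      using c1 R by (simp add: c2_def add_pos_nonneg)
    have main: "Pe_max W n M enc dec > exp (- (real n * (E + K / sqrt (real n))))"
      if n: "n \<ge> N" and code: "is_code n R M enc" for n M enc dec
    proof -
      define r where "r = sqrt (real n)"
      have n0: "n > 0"
        using n by (simp add: N_def)
      have r: "r \<ge> 1" and rr: "r * r = real n"
        using n0 by (auto simp: r_def)
      have "c2\<^sup>2 < real n"
        using n by (simp add: N_def) linarith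
      then have c2r: "c2 < r"
        using c2 by (simp add: r_def real_less_rsqrt)
      have ln4: "ln 4 < (2 :: real)"
        using ln_realpow[of 2 2] ln_2_less_1 by simp
      have lnn: "ln (real n + 1) \<le> 2 * r"
      proof -
        have "real n + 1 \<le> (1 + r)\<^sup>2"
          using r rr by (simp add: power2_eq_square algebra_simps)
        then have "ln (real n + 1) \<le> ln ((1 + r)\<^sup>2)"
          by (intro ln_mono) auto
        also have "\<dots> = 2 * ln (1 + r)"
          using r by (simp add: ln_realpow)
        also have "\<dots> \<le> 2 * r"
          using ln_add_one_self_le_self[of r] r by simp
        finally show ?thesis .
      qed
      have "exp (- (real n * (E + c2 / r * L + 1 / r) + c1 * r)) / 4 \<le> Pe_max W n M enc dec"
      proof (rule code_error_lower_bound[where R = R])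
        show "k / (1 - s) - s / (1 - s) * R \<le> E"
          if "0 < s" "s < 1" "\<And>q :: 'y pmf. (\<And>y. pmf q y > 0) \<Longrightarrow>
            k \<le> (\<Sum>x\<in>UNIV. pmf p x * - ln (renyi_sum s (pmf (W x)) (pmf q)))" for p :: "'x pmf" and s k
          using E_ge[OF that] by (simp add: E)
        show "4 * (real n * (8 * real CARD('y) + 2 * L\<^sup>2)) \<le> (c1 * r)\<^sup>2"
          using v n0 by (simp add: c1_def r_def power_mult_distrib v_def[symmetric])
        have "real CARD('x) * ln (real n + 1) \<le> real CARD('x) * (2 * r)"
          by (intro mult_left_mono lnn) simp
        moreover have "real n * (c2 / r) * R = c1 * r + real CARD('x) * (2 * r) + 2 * r"
        proof -
          have "real n * (c2 / r) * R = (c2 * R) * r"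
            using r by (simp add: rr[symmetric])
          also have "c2 * R = c1 + 2 * real CARD('x) + 2"
            using R by (simp add: c2_def)
          finally show ?thesis
            by (simp add: algebra_simps)
        qed
        ultimately show "c1 * r + real CARD('x) * ln (real n + 1) + ln 4 \<le> real n * (c2 / r) * R"
          using ln4 r by linarith
      qed (use L R c1 c2 c2r r E0 code n0 in auto)
      moreover have "exp (- (real n * (E + K / r))) < exp (- (real n * (E + c2 / r * L + 1 / r) + c1 * r)) / 4"
      proof -
        have "c2 * L * r \<le> c2 * \<bar>L\<bar> * r"
          using c2 r by (intro mult_right_mono mult_left_mono) auto
        moreover have "real n * (x / r) = x * r" for x
          using r by (simp add: rr[symmetric])
        from this[of K] this[of "c2 * L"] this[of 1]
        have "real n * (E + K / r) = real n * E + (c2 * \<bar>L\<bar> * r + c1 * r + 3 * r)"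
          "real n * (E + c2 / r * L + 1 / r) = real n * E + c2 * L * r + r"
          by (simp_all add: distrib_left distrib_right K_def)
        ultimately have "- (real n * (E + K / r)) < - (real n * (E + c2 / r * L + 1 / r) + c1 * r) - ln 4"
          using r ln4 by linarith
        then have "exp (- (real n * (E + K / r))) <
            exp (- (real n * (E + c2 / r * L + 1 / r) + c1 * r) - ln 4)"
          by (simp only: exp_less_cancel_iff)
        also have "\<dots> = exp (- (real n * (E + c2 / r * L + 1 / r) + c1 * r)) / 4"
          by (simp add: exp_diff)
        finally show ?thesis .
      qed
      ultimately show ?thesis
        by (simp add: r_def)
    qed
    have K: "K \<ge> 0"
      using c1 c2 by (simp add: K_def)
    have "?claim1 K N (\<lambda>_. 0) (\<lambda>n. K / sqrt (real n))"
      using main K by (simp add: E)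
    moreover have "error_exponent W R \<le> ereal E"
    proof -
      have bound: "best_err W n R \<ge> exp (- (real n * (E + K / sqrt (real n))))" if "n \<ge> N" for n
        unfolding best_err_def
      proof (rule cInf_greatest)
        \<comment> \<open>Some code of rate \<open>R\<close> must exist, since the infimum of an
          empty set of reals would carry no bound.\<close>
        have "is_code n R (nat \<lceil>exp (real n * R)\<rceil>) (\<lambda>_. replicate n undefined)"
          by (simp add: is_code_def real_nat_ceiling_ge)
        then show "{Pe_max W n M enc dec |M enc dec. is_code n R M enc} \<noteq> {}"
          by blast
      qed (use main[OF that] in \<open>auto intro: less_imp_le\<close>)
      have "error_exponent W R \<le> limsup (\<lambda>n. ereal (E + K / sqrt (real n)))"
        unfolding error_exponent_def
      proof (rule Limsup_mono, rule eventually_sequentiallyI[of N])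
        fix n assume n: "n \<ge> N"
        then have n0: "real n > 0"
          by (simp add: N_def)
        \<comment> \<open>Rules out the infinite branch in \<open>error_exponent\<close>.\<close>
        have pos: "best_err W n R > 0"
          using less_le_trans[OF exp_gt_zero bound[OF n]] .
        then have "- (real n * (E + K / sqrt (real n))) \<le> ln (best_err W n R)"
          using bound[OF n] by (simp add: ln_ge_iff)
        then have "- ln (best_err W n R) / real n \<le> E + K / sqrt (real n)"
          using n0 by (subst pos_divide_le_eq) (simp_all add: mult.commute)
        then show "(if best_err W n R = 0 then \<infinity> else ereal (- ln (best_err W n R) / real n)) \<le>
            ereal (E + K / sqrt (real n))"
          using pos by simp
      qed
      also have "limsup (\<lambda>n. ereal (E + K / sqrt (real n))) = ereal E"
      proof (rule lim_imp_Limsup)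
        have "(\<lambda>n. E + K / sqrt (real n)) \<longlonglongrightarrow> E + 0"
          by (intro tendsto_add tendsto_const tendsto_divide_0[OF tendsto_const]
              filterlim_at_top_imp_at_infinity filterlim_compose[OF sqrt_at_top] filterlim_real_sequentially)
        then show "(\<lambda>n. ereal (E + K / sqrt (real n))) \<longlonglongrightarrow> ereal E"
          by simp
      qed simp
      finally show ?thesis .
    qed
    ultimately show ?thesis
      unfolding E
      by - (rule conjI, rule exI[of _ K], rule exI[of _ N], rule exI[of _ "\<lambda>_. 0"],
          rule exI[of _ "\<lambda>n. K / sqrt (real n)"])
  qed
qed

end
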